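(* Let $p$ be a prime, let $r=p^k$ for some $k\ge 1$, and let $M$ be an integer $r\times r$ matrix of the form $$M=pN+C$$ for some $r\times r$ integer matrix $N$ and some permutation matrix $C$ that corresponds to a permutation (of $\{1,\ldots,r\}$) of order $p^m$ for some $m\ge 0$. Then: 1. the group $\mathbb{G}_M$ is generated by a finite $p$-automaton; 2. the group $\mathbb{G}_M$ is residually $p$-finite.
   Context: The group $\mathbb{G}_M$: let $A_r=\langle a_1,\ldots,a_r \mid a_ia_j=a_ja_i,\ 1\le i<j\le r\rangle$ be the free abelian group of rank $r\ge1$. For a non-degenerate integer matrix $M=(m_{ij})_{i,j=1}^r$ put $$\mathbb{G}_M=\langle A_r,t \mid a_i^{t}=a_1^{m_{i1}}\cdots a_r^{m_{ir}},\ 1\le i\le r\rangle,$$ where $a_i^t=t^{-1}a_it$. It is an ascending HNN extension of $A_r$. Automata: for a finite set $\mathsf{X}$ with $|\mathsf{X}|>1$, $\mathsf{X}^*$ denotes the set of all finite words over $\mathsf{X}$, including the empty word $\Lambda$. A finite automaton over $\mathsf{X}$ is a triple $\mathcal{A}=(Q,\lambda,\mu)$ where $Q$ is a finite non-empty set (of states), $\lambda:Q\times\mathsf{X}\to Q$ is the transition function and $\mu:Q\times\mathsf{X}\to\mathsf{X}$ is the output function. It is permutational if for every $q\in Q$ the map $\mu_q=\mu(q,\cdot):\mathsf{X}\to\mathsf{X}$ is a permutation. A finite permutational automaton is a $p$-automaton if $|\mathsf{X}|=p$ and all permutations $\mu_q$, $q\in Q$, of $\mathsf{X}$ are powers of one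 fixed cycle of length $p$ on $\mathsf{X}$. Each $\mu_q$ extends to a permutation of $\mathsf{X}^*$ (the automaton permutation at state $q$) by $\mu_q(\Lambda)=\Lambda$ and $\mu_q(xw)=\mu_q(x)\mu_{\lambda(q,x)}(w)$ for $x\in\mathsf{X}$, $w\in\mathsf{X}^*$. A group is said to be generated by a finite $p$-automaton if there is a finite $p$-automaton $\mathcal{A}=(Q,\lambda,\mu)$ such that the group is isomorphic to the group of permutations of $\mathsf{X}^*$ generated by some subset of the set of automaton permutations $\{\mu_q : q\in Q\}$. A group is residually $p$-finite if for every non-identity element there is a homomorphism to a finite $p$-group under which the image of that element is non-trivial. *)

theory Defs
  imports
    "HOL-Algebra.Generated_Groups"
    "HOL-Algebra.Elementary_Groups"
    "HOL-Algebra.Sym_Groups"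
    "HOL-Algebra.Multiplicative_Group"
    "HOL-Algebra.Bij"
    "HOL-Combinatorics.Cycles"
    "HOL-Computational_Algebra.Primes"
    "Jordan_Normal_Form.Matrix"
begin

section \<open>Group presentations\<close>

text \<open>
  A word over the generators is a list of letters \<open>(x, b)\<close>, where \<open>(x, True)\<close> stands for the
  generator \<open>x\<close> and \<open>(x, False)\<close> for its formal inverse.  A relation \<open>u = v\<close> is a pair of words.
\<close>

type_synonym 'g gword = "('g \<times> bool) list"

definition gwords :: "'g set \<Rightarrow> 'g gword set" where
  "gwords X = lists (X \<times> UNIV)"

inductive_set pres_cong :: "'g set \<Rightarrow> ('g gword \<times> 'g gword) set \<Rightarrow> ('g gword \<times> 'g gword) set"
  for X :: "'g set" and R :: "('g gword \<times> 'g gword) set" where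
  refl: "w \<in> gwords X \<Longrightarrow> (w, w) \<in> pres_cong X R"
| sym: "(u, v) \<in> pres_cong X R \<Longrightarrow> (v, u) \<in> pres_cong X R"
| trans: "(u, v) \<in> pres_cong X R \<Longrightarrow> (v, w) \<in> pres_cong X R \<Longrightarrow> (u, w) \<in> pres_cong X R"
| cancel: "u \<in> gwords X \<Longrightarrow> v \<in> gwords X \<Longrightarrow> x \<in> X \<Longrightarrow>
    (u @ [(x, b), (x, \<not> b)] @ v, u @ v) \<in> pres_cong X R"
| rel: "u \<in> gwords X \<Longrightarrow> v \<in> gwords X \<Longrightarrow> (s, t) \<in> R \<Longrightarrow> s \<in> gwords X \<Longrightarrow> t \<in> gwords X \<Longrightarrow>
    (u @ s @ v, u @ t @ v) \<in> pres_cong X R"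

definition presented_group ::
    "'g set \<Rightarrow> ('g gword \<times> 'g gword) set \<Rightarrow> 'g gword set monoid" where
  "presented_group X R =
    \<lparr>carrier = gwords X // pres_cong X R,
     mult = (\<lambda>A B. \<Union>u\<in>A. \<Union>v\<in>B. pres_cong X R `` {u @ v}),
     one = pres_cong X R `` {[]}\<rparr>"

definition gword_power :: "'g \<Rightarrow> int \<Rightarrow> 'g gword" where
  "gword_power x n = replicate (nat \<bar>n\<bar>) (x, 0 \<le> n)"

lemma gwords_append [simp]: "u @ v \<in> gwords X \<longleftrightarrow> u \<in> gwords X \<and> v \<in> gwords X"
  by (auto simp: gwords_def)

lemma gwords_Nil [simp]: "[] \<in> gwords X"
  by (auto simp: gwords_def)

lemma gwords_Cons [simp]: "(x, b) # w \<in> gwords X \<longleftrightarrow> x \<in> X \<and> w \<in> gwords X"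
  by (auto simp: gwords_def)

lemma pres_cong_gwords: "(u, v) \<in> pres_cong X R \<Longrightarrow> u \<in> gwords X \<and> v \<in> gwords X"
  by (induction rule: pres_cong.induct) auto

lemma equiv_pres_cong: "equiv (gwords X) (pres_cong X R)"
proof (rule equivI)
  show "pres_cong X R \<subseteq> gwords X \<times> gwords X" using pres_cong_gwords by fast
  show "refl_on (gwords X) (pres_cong X R)" by (rule refl_onI) (rule pres_cong.refl)
  show "sym (pres_cong X R)" by (rule symI) (rule pres_cong.sym)
  show "trans (pres_cong X R)" by (rule transI) (rule pres_cong.trans)
qed

lemma pres_cong_context:
  assumes "(u, v) \<in> pres_cong X R" "a \<in> gwords X" "b \<in> gwords X"
  shows "(a @ u @ b, a @ v @ b) \<in> pres_cong X R"
  using assms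
proof (induction rule: pres_cong.induct)
  case (cancel u v x c)
  then show ?case using pres_cong.cancel[of "a @ u" X "v @ b" x c R] by simp
next
  case (rel u v s t)
  then show ?case using pres_cong.rel[of "a @ u" X "v @ b" s t R] by simp
next
  case (refl w)
  then show ?case by (intro pres_cong.refl) simp
next
  case (sym u v)
  then show ?case by (blast intro: pres_cong.sym)
next
  case (trans u v w)
  then show ?case using pres_cong.trans by blast
qed

lemma pres_cong_append:
  assumes "(u, u') \<in> pres_cong X R" "(v, v') \<in> pres_cong X R"
  shows "(u @ v, u' @ v') \<in> pres_cong X R"
proof (rule pres_cong.trans)
  show "(u @ v, u' @ v) \<in> pres_cong X R"
    using pres_cong_context[OF assms(1), of "[]" v] pres_cong_gwords[OF assms(2)] by simp
  show "(u' @ v, u' @ v') \<in> pres_cong X R"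
    using pres_cong_context[OF assms(2), of u' "[]"] pres_cong_gwords[OF assms(1)] by simp
qed

lemma presented_group_mult:
  assumes "u \<in> gwords X" "v \<in> gwords X"
  shows "(pres_cong X R `` {u}) \<otimes>\<^bsub>presented_group X R\<^esub> (pres_cong X R `` {v}) =
    pres_cong X R `` {u @ v}"
proof -
  have eq: "pres_cong X R `` {u' @ v'} = pres_cong X R `` {u @ v}"
    if "(u, u') \<in> pres_cong X R" "(v, v') \<in> pres_cong X R" for u' v'
    using equiv_class_eq[OF equiv_pres_cong pres_cong_append[OF that]] by (rule HOL.sym)
  have ne: "u \<in> pres_cong X R `` {u}" "v \<in> pres_cong X R `` {v}"
    using pres_cong.refl[OF assms(1)] pres_cong.refl[OF assms(2)] by blast+
  have "(pres_cong X R `` {u}) \<otimes>\<^bsub>presented_group X R\<^esub> (pres_cong X R `` {v}) =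
      (\<Union>u'\<in>pres_cong X R `` {u}. \<Union>v'\<in>pres_cong X R `` {v}. pres_cong X R `` {u' @ v'})"
    by (simp only: presented_group_def monoid.simps)
  also have "\<dots> = (\<Union>u'\<in>pres_cong X R `` {u}. \<Union>v'\<in>pres_cong X R `` {v}. pres_cong X R `` {u @ v})"
    by (intro SUP_cong HOL.refl eq) (simp_all only: Image_singleton_iff)
  also have "\<dots> = pres_cong X R `` {u @ v}"
    using ne by (metis UN_constant empty_iff)
  finally show ?thesis .
qed

lemma pres_cong_inverse:
  "w \<in> gwords X \<Longrightarrow> (rev (map (\<lambda>(x, b). (x, \<not> b)) w) @ w, []) \<in> pres_cong X R
     \<and> rev (map (\<lambda>(x, b). (x, \<not> b)) w) \<in> gwords X"
proof (induction w)
  case (Cons y w)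
  obtain x b where y: "y = (x, b)" by force
  let ?i = "rev (map (\<lambda>(x, b). (x, \<not> b)) w)"
  have *: "x \<in> X" "w \<in> gwords X" "?i \<in> gwords X" "(?i @ w, []) \<in> pres_cong X R"
    using Cons y by auto
  have "(?i @ [(x, \<not> b), (x, \<not> \<not> b)] @ w, ?i @ w) \<in> pres_cong X R"
    using * by (intro pres_cong.cancel)
  then have "(?i @ [(x, \<not> b), (x, \<not> \<not> b)] @ w, []) \<in> pres_cong X R"
    using *(4) by (rule pres_cong.trans)
  then show ?case using * y by simp
qed (auto intro: pres_cong.refl)

lemma group_presented_group: "group (presented_group X R)"
proof (rule groupI)
  let ?G = "presented_group X R" and ?c = "\<lambda>w. pres_cong X R `` {w}"
  have carr: "carrier ?G = ?c ` gwords X"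
    by (auto simp: presented_group_def quotient_def)
  have one: "\<one>\<^bsub>?G\<^esub> = ?c []" by (simp add: presented_group_def)
  show "\<one>\<^bsub>?G\<^esub> \<in> carrier ?G" by (auto simp: carr one)
  fix a assume "a \<in> carrier ?G"
  then obtain u where u: "u \<in> gwords X" "a = ?c u" by (auto simp: carr)
  show "\<one>\<^bsub>?G\<^esub> \<otimes>\<^bsub>?G\<^esub> a = a" using u by (simp add: one presented_group_mult)
  let ?i = "rev (map (\<lambda>(x, b). (x, \<not> b)) u)"
  have i: "?i \<in> gwords X" "(?i @ u, []) \<in> pres_cong X R" using pres_cong_inverse u by blast+
  have "?c ?i \<otimes>\<^bsub>?G\<^esub> a = \<one>\<^bsub>?G\<^esub>"
    using u i equiv_class_eq[OF equiv_pres_cong i(2)] by (simp add: one presented_group_mult)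
  then show "\<exists>b\<in>carrier ?G. b \<otimes>\<^bsub>?G\<^esub> a = \<one>\<^bsub>?G\<^esub>" using i by (auto simp: carr)
  fix b assume "b \<in> carrier ?G"
  then obtain v where v: "v \<in> gwords X" "b = ?c v" by (auto simp: carr)
  show "a \<otimes>\<^bsub>?G\<^esub> b \<in> carrier ?G" using u v by (auto simp: carr presented_group_mult)
  fix c assume "c \<in> carrier ?G"
  then obtain w where w: "w \<in> gwords X" "c = ?c w" by (auto simp: carr)
  show "a \<otimes>\<^bsub>?G\<^esub> b \<otimes>\<^bsub>?G\<^esub> c = a \<otimes>\<^bsub>?G\<^esub> (b \<otimes>\<^bsub>?G\<^esub> c)"
    using u v w by (simp add: presented_group_mult)
qed

section \<open>The group of an integer matrix\<close>

datatype GM_gen = Agen nat | Tgen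

text \<open>
  The generators \<open>Agen 0, \<dots>, Agen (r - 1)\<close>, for \<open>r\<close> the number of rows of \<open>M\<close>, are
  \<open>a\<^sub>1, \<dots>, a\<^sub>r\<close>; the indices are those of the entries of \<open>M\<close>, which start at 0.
\<close>

definition GM_gens :: "nat \<Rightarrow> GM_gen set" where
  "GM_gens r = Agen ` {..<r} \<union> {Tgen}"

definition GM_rels :: "int mat \<Rightarrow> (GM_gen gword \<times> GM_gen gword) set" where
  "GM_rels M =
    {([(Agen i, True), (Agen j, True)], [(Agen j, True), (Agen i, True)]) | i j.
        i < j \<and> j < dim_row M}
    \<union> {([(Tgen, False), (Agen i, True), (Tgen, True)],
        concat (map (\<lambda>j. gword_power (Agen j) (M $$ (i, j))) [0..<dim_row M])) | i.
        i < dim_row M}"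

text \<open>The definition makes sense for every square matrix; it is meant for those with
  \<open>det M \<noteq> 0\<close>.\<close>

definition GM :: "int mat \<Rightarrow> GM_gen gword set monoid" where
  "GM M = presented_group (GM_gens (dim_row M)) (GM_rels M)"

definition perm_matrix :: "nat \<Rightarrow> (nat \<Rightarrow> nat) \<Rightarrow> int mat" where
  \<comment> \<open>\<open>\<sigma>\<close> permutes \<open>{1..r}\<close>, whereas matrix indices start at 0\<close>
  "perm_matrix r \<sigma> = mat r r (\<lambda>(i, j). if \<sigma> (Suc i) = Suc j then 1 else 0)"

section \<open>Automata\<close>

record ('q, 'x) automaton =
  states :: "'q set"
  alphabet :: "'x set"
  trans_fn :: "'q \<Rightarrow> 'x \<Rightarrow> 'q"
  out_fn :: "'q \<Rightarrow> 'x \<Rightarrow> 'x"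

definition finite_automaton :: "('q, 'x) automaton \<Rightarrow> bool" where
  "finite_automaton A \<longleftrightarrow>
    finite (alphabet A) \<and> card (alphabet A) > 1 \<and> finite (states A) \<and> states A \<noteq> {} \<and>
    (\<forall>q\<in>states A. \<forall>x\<in>alphabet A. trans_fn A q x \<in> states A \<and> out_fn A q x \<in> alphabet A)"

definition permutational :: "('q, 'x) automaton \<Rightarrow> bool" where
  "permutational A \<longleftrightarrow> (\<forall>q\<in>states A. bij_betw (out_fn A q) (alphabet A) (alphabet A))"

definition p_automaton :: "nat \<Rightarrow> ('q, 'x) automaton \<Rightarrow> bool" where
  "p_automaton p A \<longleftrightarrow>
    finite_automaton A \<and> permutational A \<and> card (alphabet A) = p \<and>
    (\<exists>cs. cycle cs \<and> set cs = alphabet A \<and>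
      (\<forall>q\<in>states A. \<exists>n. \<forall>x\<in>alphabet A. out_fn A q x = (cycle_of_list cs ^^ n) x))"

primrec out_word :: "('q, 'x) automaton \<Rightarrow> 'q \<Rightarrow> 'x list \<Rightarrow> 'x list" where
  "out_word A q [] = []"
| "out_word A q (x # w) = out_fn A q x # out_word A (trans_fn A q x) w"

definition autom_perm :: "('q, 'x) automaton \<Rightarrow> 'q \<Rightarrow> 'x list \<Rightarrow> 'x list" where
  "autom_perm A q = restrict (out_word A q) (lists (alphabet A))"

lemma autom_perm_in_BijGroup:
  assumes "finite_automaton A" "permutational A" "q \<in> states A"
  shows "autom_perm A q \<in> carrier (BijGroup (lists (alphabet A)))"
proof -
  let ?X = "alphabet A"
  have tr: "trans_fn A q x \<in> states A" if "q \<in> states A" "x \<in> ?X" for q x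
    using assms(1) that by (auto simp: finite_automaton_def)
  have bij: "bij_betw (out_fn A q) ?X ?X" if "q \<in> states A" for q
    using assms(2) that by (auto simp: permutational_def)
  have mem: "out_word A q w \<in> lists ?X" if "w \<in> lists ?X" "q \<in> states A" for q w
    using that by (induction w arbitrary: q) (auto simp: tr bij_betwE[OF bij])
  have inj: "v = w" if "v \<in> lists ?X" "w \<in> lists ?X" "q \<in> states A"
    "out_word A q v = out_word A q w" for q v w
    using that
  proof (induction v arbitrary: q w)
    case Nil
    then show ?case by (cases w) auto
  next
    case (Cons x v)
    then obtain y w' where w: "w = y # w'" by (cases w) auto
    have "x = y"
      using Cons.hyps Cons.prems bij[OF \<open>q \<in> states A\<close>] by (auto simp: w bij_betw_def inj_on_eq_iff)
    moreover have "v = w'"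
      using Cons.hyps Cons.prems \<open>x = y\<close> by (intro Cons.IH[of w' "trans_fn A q x"]) (simp_all add: w tr)
    ultimately show ?case by (simp add: w)
  qed
  have surj: "\<exists>v\<in>lists ?X. out_word A q v = w" if "w \<in> lists ?X" "q \<in> states A" for q w
    using that
  proof (induction w arbitrary: q)
    case Nil
    show ?case by (rule bexI[of _ "[]"]) auto
  next
    case (Cons y w)
    then have "y \<in> out_fn A q ` ?X"
      using bij[OF \<open>q \<in> states A\<close>] by (simp add: bij_betw_def)
    then obtain x where x: "x \<in> ?X" "out_fn A q x = y" by blast
    obtain v where "v \<in> lists ?X" "out_word A (trans_fn A q x) v = w"
      using Cons.IH[of "trans_fn A q x"] Cons.hyps Cons.prems x by (auto simp: tr)
    then show ?case using x by (intro bexI[of _ "x # v"]) auto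
  qed
  have "bij_betw (out_word A q) (lists ?X) (lists ?X)"
    unfolding bij_betw_def
  proof (intro conjI inj_onI equalityI subsetI)
    fix v w assume "v \<in> lists ?X" "w \<in> lists ?X" "out_word A q v = out_word A q w"
    then show "v = w" using inj[OF _ _ assms(3)] by simp
  next
    fix w assume "w \<in> out_word A q ` lists ?X"
    then show "w \<in> lists ?X" using mem[OF _ assms(3)] by auto
  next
    fix w assume "w \<in> lists ?X"
    then show "w \<in> out_word A q ` lists ?X" using surj[OF _ assms(3)] by auto
  qed
  then have "bij_betw (autom_perm A q) (lists ?X) (lists ?X)"
    unfolding autom_perm_def by simp
  then show ?thesis by (simp add: BijGroup_def Bij_def autom_perm_def)
qed

text \<open>
  States and letters are natural numbers; this is no restriction, as both sets are finite.
\<close>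

definition generated_by_finite_p_automaton :: "nat \<Rightarrow> ('g, 'b) monoid_scheme \<Rightarrow> bool" where
  "generated_by_finite_p_automaton p G \<longleftrightarrow>
    (\<exists>(A :: (nat, nat) automaton) S. p_automaton p A \<and> S \<subseteq> states A \<and>
      G \<cong> subgroup_generated (BijGroup (lists (alphabet A))) (autom_perm A ` S))"

section \<open>Residual finiteness\<close>

text \<open>Every finite group is isomorphic to one whose elements are natural numbers.\<close>

definition residually_p_finite :: "nat \<Rightarrow> ('g, 'b) monoid_scheme \<Rightarrow> bool" where
  "residually_p_finite p G \<longleftrightarrow>
    (\<forall>g\<in>carrier G. g \<noteq> \<one>\<^bsub>G\<^esub> \<longrightarrow>
      (\<exists>(H :: nat monoid) n h. group H \<and> finite (carrier H) \<and> order H = p ^ n \<and>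
        h \<in> hom G H \<and> h g \<noteq> \<one>\<^bsub>H\<^esub>))"

end

theory Submission
  imports
    Defs
    "HOL-Algebra.Sylow"
    "HOL-Library.Function_Algebras"
begin

text \<open>
  Let \<open>V = \<int>\<^sup>r \<oplus> \<int>\<close>, let \<open>T\<close> act on row vectors by \<open>M\<close> on \<open>\<int>\<^sup>r\<close> and trivially on the last
  summand.  Since \<open>M\<close> is modulo \<open>p\<close> a permutation matrix of \<open>p\<close>-power order, \<open>T\<close> is unipotent
  modulo \<open>p\<close>, so there is a chain \<open>V = F 0 > F 1 > \<dots> > F K = p V\<close> of subgroups, each of index
  \<open>p\<close> in the previous one, with \<open>T\<close> trivial on the quotients.  Continued periodically by
  \<open>F (n + K) = p F n\<close>, it makes the cosets of the \<open>F n\<close> the vertices of a \<open>p\<close>-regular tree, on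
  which the translations and the affine map \<open>\<tau> x = T x + e\<close>, with \<open>e\<close> the generator of the last
  summand, act; the action on the children of a vertex is a cyclic shift.  The section of
  \<open>x \<mapsto> T x + v\<close> at a vertex is again of this form, and as \<open>v\<close> is divided by \<open>p\<close> once per
  period, the translation parts stay bounded: finitely many states suffice.  The assignment
  \<open>a\<^sub>i \<mapsto> (x \<mapsto> x + e\<^sub>i)\<close>, \<open>t \<mapsto> \<tau>\<^sup>-\<^sup>1\<close> respects the relations.  It is faithful because every element has
  the form \<open>t\<^sup>n a\<^sup>v t\<^sup>-\<^sup>m\<close>, the last coordinate detects \<open>m - n\<close>, and \<open>\<Inter>n. F n = {0}\<close>.

  A group generated by a \<open>p\<close>-automaton is residually \<open>p\<close>-finite: on the words of length \<open>n\<close> the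
  \<open>p\<^sup>n\<close>-th power of every element is trivial, so the group induced there is a finite \<open>p\<close>-group.
\<close>

section \<open>Filtrations by subgroups of index \<open>p\<close>\<close>

type_synonym ivec = "nat \<Rightarrow> int"

text \<open>A vector of Z^R is a function that vanishes from index \<open>R\<close> on, so that the
  type does not depend on \<open>R\<close>. The ring structure on functions is pointwise and
  \<open>of_nat c\<close> is the constant function with value \<open>c\<close>; hence
  \<open>of_nat c * x\<close> is scalar multiplication.\<close>

definition ivecs :: "nat \<Rightarrow> ivec set" where
  "ivecs R = {x. \<forall>i\<ge>R. x i = 0}"

definition add_subgroup :: "'v::ab_group_add set \<Rightarrow> bool" where
  "add_subgroup H \<longleftrightarrow> 0 \<in> H \<and> (\<forall>x\<in>H. \<forall>y\<in>H. x - y \<in> H)"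

lemma of_int_fun_apply: "(of_int k :: 'a \<Rightarrow> int) i = k"
proof (cases k)
  case (nonneg n)
  then show ?thesis by (simp add: of_nat_fun)
next
  case (neg n)
  then show ?thesis by (simp add: of_nat_fun del: of_nat_Suc)
qed

text \<open>Induction leaves terms of function type in eta-expanded form, to which the simplifier
  would apply these rules.\<close>

lemmas pointwise = plus_fun_apply minus_apply uminus_apply times_fun_apply zero_fun_apply
  one_fun_apply of_nat_fun_apply of_int_fun_apply

declare plus_fun_apply [simp del] minus_apply [simp del] uminus_apply [simp del]
  times_fun_apply [simp del] zero_fun_apply [simp del] one_fun_apply [simp del]
  of_nat_fun_apply [simp del]

context
  fixes H :: "'v::ab_group_add set"
  assumes H: "add_subgroup H"
begin

lemma add_subgroup_0: "0 \<in> H"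
  using H by (simp add: add_subgroup_def)

lemma add_subgroup_diff: "x \<in> H \<Longrightarrow> y \<in> H \<Longrightarrow> x - y \<in> H"
  using H by (simp add: add_subgroup_def)

lemma add_subgroup_uminus: "x \<in> H \<Longrightarrow> - x \<in> H"
  using add_subgroup_diff[OF add_subgroup_0] by fastforce

lemma add_subgroup_add: "x \<in> H \<Longrightarrow> y \<in> H \<Longrightarrow> x + y \<in> H"
  using add_subgroup_diff[of x "- y"] add_subgroup_uminus by simp

lemma add_subgroup_diff_iff: "y \<in> H \<Longrightarrow> x - y \<in> H \<longleftrightarrow> x \<in> H"
  using add_subgroup_add[of "x - y" y] add_subgroup_diff by auto

lemma add_subgroup_add_iff: "y \<in> H \<Longrightarrow> x + y \<in> H \<longleftrightarrow> x \<in> H"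
  using add_subgroup_diff[of "x + y" y] add_subgroup_add by auto

end

lemma add_subgroup_of_nat_mult:
  fixes H :: "'v::comm_ring_1 set"
  assumes "add_subgroup H" "x \<in> H"
  shows "of_nat k * x \<in> H"
  using assms
  by (induction k) (auto simp: algebra_simps intro: add_subgroup_0 add_subgroup_add)

lemma add_subgroup_of_int_mult:
  fixes H :: "'v::comm_ring_1 set"
  assumes "add_subgroup H" "x \<in> H"
  shows "of_int k * x \<in> H"
proof (cases k)
  case (nonneg n)
  then show ?thesis using add_subgroup_of_nat_mult[OF assms] by simp
next
  case (neg n)
  then show ?thesis
    using add_subgroup_uminus[OF assms(1) add_subgroup_of_nat_mult[OF assms, of "Suc n"]]
    by (simp del: of_nat_Suc)
qed

lemma add_subgroup_ivecs: "add_subgroup (ivecs R)"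
  by (auto simp: add_subgroup_def ivecs_def pointwise)

lemma add_subgroup_scale:
  fixes H :: "'v::comm_ring_1 set"
  assumes "add_subgroup H"
  shows "add_subgroup ((*) c ` H)"
  unfolding add_subgroup_def
proof (intro conjI ballI)
  show "0 \<in> (*) c ` H" using add_subgroup_0[OF assms] by (auto intro!: image_eqI[of _ _ 0])
  fix x y assume "x \<in> (*) c ` H" "y \<in> (*) c ` H"
  then obtain x' y' where "x = c * x'" "y = c * y'" "x' \<in> H" "y' \<in> H" by blast
  then show "x - y \<in> (*) c ` H"
    using add_subgroup_diff[OF assms, of x' y']
    by (auto intro!: image_eqI[of _ _ "x' - y'"] simp: algebra_simps)
qed

text \<open>With \<open>V = ivecs R\<close>, these are the preimages in \<open>V\<close> of the
  subgroups of \<open>V / p V\<close>; the filtration is built among them.\<close>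

definition intermediate_subgroups :: "nat \<Rightarrow> nat \<Rightarrow> ivec set set" where
  "intermediate_subgroups p R =
    {H. add_subgroup H \<and> (*) (of_nat p) ` ivecs R \<subseteq> H \<and> H \<subseteq> ivecs R}"

text \<open>Reducing all entries modulo \<open>p\<close> changes a vector by an element of
  \<open>p V\<close>. So such a subgroup is determined by its vectors with entries in
  \<open>{0..<p}\<close>, and there are only finitely many sets of those.\<close>

lemma finite_intermediate_subgroups:
  assumes "p > 0"
  shows "finite (intermediate_subgroups p R)"
proof -
  define D where "D = {f :: ivec. \<forall>i. (i \<in> {..<R} \<longrightarrow> f i \<in> {0..<int p}) \<and> (i \<notin> {..<R} \<longrightarrow> f i = 0)}"
  define red where "red x = (\<lambda>i. x i mod int p)" for x :: ivec
  have "finite D"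
    unfolding D_def by (intro finite_set_of_finite_funs) auto
  have "H \<in> (\<lambda>E. {x \<in> ivecs R. red x \<in> E}) ` Pow D" if "H \<in> intermediate_subgroups p R" for H
  proof (rule image_eqI)
    have H: "add_subgroup H" "(*) (of_nat p) ` ivecs R \<subseteq> H" "H \<subseteq> ivecs R"
      using that by (auto simp: intermediate_subgroups_def)
    have "red x \<in> H \<inter> D \<longleftrightarrow> x \<in> H" if "x \<in> ivecs R" for x
    proof -
      have eq: "red x = x - of_nat p * (\<lambda>i. x i div int p)"
        by (auto simp: red_def minus_mult_div_eq_mod pointwise)
      have "(\<lambda>i. x i div int p) \<in> ivecs R" using that by (auto simp: ivecs_def)
      then have "red x \<in> H \<longleftrightarrow> x \<in> H"
        unfolding eq using H by (intro add_subgroup_diff_iff) auto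
      moreover have "red x \<in> D" using that assms by (auto simp: red_def D_def ivecs_def)
      ultimately show ?thesis by blast
    qed
    then show "H = {x \<in> ivecs R. red x \<in> H \<inter> D}" using H by blast
  qed auto
  then have "intermediate_subgroups p R \<subseteq> (\<lambda>E. {x \<in> ivecs R. red x \<in> E}) ` Pow D" by blast
  then show ?thesis
    using \<open>finite D\<close> finite_subset by blast
qed

text \<open>The index of \<open>H'\<close> in \<open>H\<close> is expressed through digits instead
  of being counted. For prime \<open>p\<close> and
  \<open>p V \<subseteq> H' \<subset> H \<subseteq> V\<close> the digit condition makes it exactly
  \<open>p\<close>.\<close>

definition filtration_step :: "nat \<Rightarrow> (ivec \<Rightarrow> ivec) \<Rightarrow> ivec set \<Rightarrow> ivec set \<Rightarrow> ivec \<Rightarrow> bool" where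
  "filtration_step p T H H' b \<longleftrightarrow> H' \<subset> H \<and> (\<forall>x\<in>H. T x - x \<in> H') \<and> b \<in> H \<and>
    (\<forall>x\<in>H. \<exists>d<p. x - of_nat d * b \<in> H')"

text \<open>Since \<open>T - 1\<close> is nilpotent modulo \<open>p\<close>, \<open>(T - 1) H + p V\<close> is a proper subgroup
  of \<open>H\<close>; any maximal proper subgroup of \<open>H\<close> above it will do.\<close>

lemma filtration_step_exists:
  assumes "p > 0" and H: "H \<in> intermediate_subgroups p R" "H \<noteq> (*) (of_nat p) ` ivecs R"
    and add: "\<And>x y. T (x + y) = T x + T y" and TV: "T ` ivecs R \<subseteq> ivecs R"
    and inv: "T ` H \<subseteq> H"
    and nilp: "\<And>x. x \<in> ivecs R \<Longrightarrow> ((\<lambda>y. T y - y) ^^ q) x \<in> (*) (of_nat p) ` ivecs R"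
  shows "\<exists>H'\<in>intermediate_subgroups p R. \<exists>b. filtration_step p T H H' b"
proof -
  let ?pV = "(*) (of_nat p) ` ivecs R"
  define \<Delta> where "\<Delta> y = T y - y" for y
  have pV: "add_subgroup ?pV" by (intro add_subgroup_scale add_subgroup_ivecs)
  have sub: "add_subgroup H" "?pV \<subseteq> H" "H \<subseteq> ivecs R"
    using H by (auto simp: intermediate_subgroups_def)
  have \<Delta>_add: "\<Delta> (x + y) = \<Delta> x + \<Delta> y" for x y by (simp add: \<Delta>_def add)
  have \<Delta>_diff: "\<Delta> (x - y) = \<Delta> x - \<Delta> y" for x y
    using \<Delta>_add[of "x - y" y] by (simp add: algebra_simps)
  have \<Delta>_0: "\<Delta> 0 = 0" using \<Delta>_diff[of 0 0] by simp
  have \<Delta>_H: "\<Delta> x \<in> H" if "x \<in> H" for x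
    using that inv by (auto simp: \<Delta>_def intro: add_subgroup_diff[OF sub(1)])
  have \<Delta>_p: "\<Delta> x \<in> ?pV" if "x \<in> ?pV" for x
  proof -
    obtain y where y: "y \<in> ivecs R" "x = of_nat p * y" using \<open>x \<in> ?pV\<close> by blast
    have "\<Delta> (of_nat k * y) = of_nat k * \<Delta> y" for k
      by (induction k) (simp_all add: \<Delta>_0 \<Delta>_add algebra_simps)
    moreover have "\<Delta> y \<in> ivecs R"
      using y(1) TV add_subgroup_diff[OF add_subgroup_ivecs, of "T y" R y] by (auto simp: \<Delta>_def)
    ultimately show ?thesis using y by auto
  qed
  define \<H> where "\<H> = {H' \<in> intermediate_subgroups p R. H' \<subset> H \<and> (\<forall>x\<in>H. \<Delta> x \<in> H')}"
  define H0 where "H0 = {\<Delta> x + y |x y. x \<in> H \<and> y \<in> ?pV}"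
  have sub_H0: "add_subgroup H0"
    unfolding add_subgroup_def
  proof (intro conjI ballI)
    show "0 \<in> H0"
      using add_subgroup_0[OF sub(1)] add_subgroup_0[OF pV] \<Delta>_0 unfolding H0_def by force
    fix u v assume "u \<in> H0" "v \<in> H0"
    then obtain x y x' y' where uv: "u = \<Delta> x + y" "v = \<Delta> x' + y'" "x \<in> H" "x' \<in> H" "y \<in> ?pV" "y' \<in> ?pV"
      unfolding H0_def by blast
    then have "u - v = \<Delta> (x - x') + (y - y')" by (simp add: \<Delta>_diff)
    then show "u - v \<in> H0"
      using uv add_subgroup_diff[OF sub(1)] add_subgroup_diff[OF pV] unfolding H0_def by blast
  qed
  have "?pV \<subseteq> H0"
  proof
    fix y assume "y \<in> ?pV"
    then show "y \<in> H0" unfolding H0_def using add_subgroup_0[OF sub(1)] \<Delta>_0 by force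
  qed
  have \<Delta>_H0: "\<Delta> x \<in> H0" if "x \<in> H" for x
    unfolding H0_def using that add_subgroup_0[OF pV] by force
  have "H0 \<subseteq> H"
    using \<Delta>_H sub(2) unfolding H0_def by (auto intro!: add_subgroup_add[OF sub(1)])
  have "H0 \<noteq> H"
  proof
    \<comment> \<open>If \<open>H = \<Delta> H + p V\<close>, iteration gives
      \<open>H = \<Delta>^n H + p V\<close> for every \<open>n\<close>; nilpotence at
      \<open>n = q\<close> then yields \<open>H \<subseteq> p V\<close>.\<close>
    assume "H0 = H"
    have "\<exists>x\<in>H. \<exists>y\<in>?pV. h = (\<Delta> ^^ n) x + y" if "h \<in> H" for h n
      using that
    proof (induction n arbitrary: h)
      case 0
      then show ?case using add_subgroup_0[OF pV] by force
    next
      case (Suc n)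
      obtain x y where xy: "x \<in> H" "y \<in> ?pV" "h = \<Delta> x + y"
        using Suc.prems \<open>H0 = H\<close> unfolding H0_def by blast
      obtain x' y' where xy': "x' \<in> H" "y' \<in> ?pV" "x = (\<Delta> ^^ n) x' + y'"
        using Suc.IH[OF xy(1)] by blast
      have "h = (\<Delta> ^^ Suc n) x' + (\<Delta> y' + y)"
        using xy xy' by (simp add: \<Delta>_add)
      moreover have "\<Delta> y' + y \<in> ?pV"
        using \<Delta>_p[OF xy'(2)] xy(2) by (rule add_subgroup_add[OF pV])
      ultimately show ?case using xy'(1) by blast
    qed
    moreover have "(\<Delta> ^^ q) x \<in> ?pV" if "x \<in> H" for x
      unfolding \<Delta>_def using that sub(3) by (intro nilp) blast
    ultimately have "H \<subseteq> ?pV"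
      using add_subgroup_add[OF pV] by (metis subsetI)
    then show False using sub(2) H(2) by blast
  qed
  have "H0 \<in> \<H>"
    using sub_H0 \<open>?pV \<subseteq> H0\<close> \<open>H0 \<subseteq> H\<close> \<open>H0 \<noteq> H\<close> \<Delta>_H0 sub(3)
    unfolding \<H>_def intermediate_subgroups_def by blast
  then have "\<H> \<noteq> {}" by blast
  moreover have "finite \<H>"
    using finite_intermediate_subgroups[OF assms(1)] by (auto simp: \<H>_def)
  ultimately obtain H' where H': "H' \<in> \<H>" and max: "\<And>E. E \<in> \<H> \<Longrightarrow> H' \<subseteq> E \<Longrightarrow> H' = E"
    using finite_has_maximal[of \<H>] by metis
  have s': "add_subgroup H'" "?pV \<subseteq> H'" "H' \<subset> H" "\<And>x. x \<in> H \<Longrightarrow> \<Delta> x \<in> H'"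
    using H' by (auto simp: \<H>_def intermediate_subgroups_def)
  then obtain b where b: "b \<in> H" "b \<notin> H'" by blast
  \<comment> \<open>\<open>E\<close> is generated by \<open>H'\<close> and \<open>b\<close>. If it
    were proper in \<open>H\<close>, it would contradict the maximality of \<open>H'\<close>; hence
    \<open>H / H'\<close> is cyclic.\<close>
  define E where "E = {y + of_int k * b |y k. y \<in> H'}"
  have sub_E: "add_subgroup E"
    unfolding add_subgroup_def
  proof (intro conjI ballI)
    show "0 \<in> E" unfolding E_def using add_subgroup_0[OF s'(1)] by (force intro: exI[of _ 0])
    fix x y assume "x \<in> E" "y \<in> E"
    then obtain x' y' k l where "x' \<in> H'" "y' \<in> H'" "x = x' + of_int k * b" "y = y' + of_int l * b"
      by (auto simp: E_def)
    then have "x - y = (x' - y') + of_int (k - l) * b" "x' - y' \<in> H'"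
      using add_subgroup_diff[OF s'(1)] by (simp_all add: algebra_simps)
    then show "x - y \<in> E" unfolding E_def by blast
  qed
  have "H' \<subseteq> E" unfolding E_def by (force intro: exI[of _ 0])
  have "b \<in> E" unfolding E_def using add_subgroup_0[OF s'(1)] by (force intro: exI[of _ 1])
  have "E \<subseteq> H" unfolding E_def
    using s' b by (auto intro!: add_subgroup_add[OF sub(1)] add_subgroup_of_int_mult[OF sub(1)])
  have "E = H"
  proof (rule ccontr)
    assume "E \<noteq> H"
    then have "E \<in> \<H>"
      using \<open>E \<subseteq> H\<close> \<open>H' \<subseteq> E\<close> sub_E s' sub by (auto simp: \<H>_def intermediate_subgroups_def)
    then show False using max[of E] \<open>H' \<subseteq> E\<close> \<open>b \<in> E\<close> b by blast
  qed
  have "\<exists>d<p. x - of_nat d * b \<in> H'" if "x \<in> H" for x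
  proof -
    obtain y k where x: "y \<in> H'" "x = y + of_int k * b" using \<open>x \<in> H\<close> \<open>E = H\<close> by (auto simp: E_def)
    \<comment> \<open>The digit is the residue of \<open>k\<close>; the remaining multiple of
      \<open>p\<close> contributes a vector of \<open>p V\<close>, which lies in
      \<open>H'\<close>.\<close>
    define d where "d = nat (k mod int p)"
    have "k = int d + int p * (k div int p)" using assms(1) by (simp add: d_def)
    then have "of_int k = (of_nat d + of_nat p * of_int (k div int p) :: ivec)"
      by (metis of_int_add of_int_mult of_int_of_nat_eq)
    then have "x - of_nat d * b = y + of_nat p * (of_int (k div int p) * b)"
      using x by (simp add: algebra_simps)
    moreover have "of_nat p * (of_int (k div int p) * b) \<in> ?pV"
      using b sub add_subgroup_of_int_mult[OF add_subgroup_ivecs] by blast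
    ultimately have "x - of_nat d * b \<in> H'"
      using add_subgroup_add[OF s'(1) x(1)] s'(2) by (metis subsetD)
    moreover have "d < p" using assms(1) by (simp add: d_def nat_less_iff)
    ultimately show ?thesis by blast
  qed
  then have "filtration_step p T H H' b"
    using s' b by (auto simp: filtration_step_def \<Delta>_def)
  then show ?thesis using H' by (auto simp: \<H>_def)
qed

text \<open>Repeated steps reach \<open>p V\<close>, because the number of intermediate subgroups
  strictly inside \<open>H\<close> drops each time.\<close>

lemma filtration_exists:
  assumes "p > 0" and H: "H \<in> intermediate_subgroups p R"
    and add: "\<And>x y. T (x + y) = T x + T y" and TV: "T ` ivecs R \<subseteq> ivecs R"
    and inv: "T ` H \<subseteq> H"
    and nilp: "\<And>x. x \<in> ivecs R \<Longrightarrow> ((\<lambda>y. T y - y) ^^ q) x \<in> (*) (of_nat p) ` ivecs R"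
  shows "\<exists>K F \<beta>. F 0 = H \<and> F K = (*) (of_nat p) ` ivecs R \<and>
    (\<forall>n\<le>K. F n \<in> intermediate_subgroups p R) \<and> (\<forall>n<K. filtration_step p T (F n) (F (Suc n)) (\<beta> n))"
  using H inv
proof (induction "card {E \<in> intermediate_subgroups p R. E \<subset> H}" arbitrary: H rule: less_induct)
  case less
  show ?case
  proof (cases "H = (*) (of_nat p) ` ivecs R")
    case True
    then show ?thesis using less.prems by (intro exI[of _ 0] exI[of _ "\<lambda>_. H"]) auto
  next
    case False
    obtain H' b where H': "H' \<in> intermediate_subgroups p R" "filtration_step p T H H' b"
      using filtration_step_exists[OF assms(1) less.prems(1) False add TV less.prems(2) nilp] by blast
    have "{E \<in> intermediate_subgroups p R. E \<subset> H'} \<subset> {E \<in> intermediate_subgroups p R. E \<subset> H}"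
      using H' unfolding filtration_step_def by blast
    then have "card {E \<in> intermediate_subgroups p R. E \<subset> H'} < card {E \<in> intermediate_subgroups p R. E \<subset> H}"
      by (intro psubset_card_mono) (simp_all add: finite_intermediate_subgroups[OF assms(1)])
    \<comment> \<open>Invariance is inherited: for \<open>x\<close> in \<open>H'\<close>,
      \<open>T x\<close> differs from \<open>x\<close> by an element of \<open>H'\<close>.\<close>
    moreover have "T ` H' \<subseteq> H'"
    proof (rule image_subsetI)
      fix x assume "x \<in> H'"
      moreover have "T x - x \<in> H'" using \<open>x \<in> H'\<close> H' by (auto simp: filtration_step_def)
      ultimately show "T x \<in> H'"
        using H'(1) add_subgroup_diff_iff by (auto simp: intermediate_subgroups_def)
    qed
    ultimately obtain K F \<beta> where F: "F 0 = H'" "F K = (*) (of_nat p) ` ivecs R"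
      "\<forall>n\<le>K. F n \<in> intermediate_subgroups p R" "\<forall>n<K. filtration_step p T (F n) (F (Suc n)) (\<beta> n)"
      using less.hyps[of H'] H'(1) by blast
    show ?thesis
    proof (intro exI conjI allI impI)
      show "case_nat H F (Suc K) = (*) (of_nat p) ` ivecs R" using F by simp
    next
      fix n assume "n \<le> Suc K"
      then show "case_nat H F n \<in> intermediate_subgroups p R"
        using F(3) less.prems by (auto split: nat.split)
    next
      fix n assume "n < Suc K"
      then show "filtration_step p T (case_nat H F n) (case_nat H F (Suc n)) (case_nat b \<beta> n)"
        using F(1,4) H' by (auto split: nat.split)
    qed simp
  qed
qed

section \<open>Binomial expansion and unipotence modulo p\<close>

text \<open>Pascal's rule in summed form, the inductive step of the binomial expansion
  below.\<close>

lemma sum_pascal: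
  fixes y :: "nat \<Rightarrow> 'v::comm_ring_1"
  shows "(\<Sum>j\<le>n. of_nat (n choose j) * (y j + y (Suc j))) = (\<Sum>j\<le>Suc n. of_nat (Suc n choose j) * y j)"
proof -
  \<comment> \<open>The added term has coefficient \<open>n choose Suc n\<close>, which is
    0.\<close>
  have "(\<Sum>j\<le>n. of_nat (n choose j) * y j) = (\<Sum>j\<le>Suc n. of_nat (n choose j) * y j)"
    by (simp add: binomial_eq_0)
  also have "\<dots> = y 0 + (\<Sum>j\<le>n. of_nat (n choose Suc j) * y (Suc j))"
    by (subst sum.atMost_Suc_shift) simp
  finally have "(\<Sum>j\<le>n. of_nat (n choose j) * (y j + y (Suc j))) =
      y 0 + ((\<Sum>j\<le>n. of_nat (n choose Suc j) * y (Suc j)) + (\<Sum>j\<le>n. of_nat (n choose j) * y (Suc j)))"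
    by (simp only: distrib_left sum.distrib add.assoc)
  also have "\<dots> = y 0 + (\<Sum>j\<le>n. of_nat (Suc n choose Suc j) * y (Suc j))"
    by (simp add: sum.distrib[symmetric] distrib_right add.commute)
  also have "\<dots> = (\<Sum>j\<le>Suc n. of_nat (Suc n choose j) * y j)"
    by (subst sum.atMost_Suc_shift) simp
  finally show ?thesis .
qed

text \<open>The binomial theorem for \<open>T = 1 + (T - 1)\<close> with commuting summands.
  \<open>T\<close> is merely additive, so its compatibility with natural multiples and finite sums
  is derived first.\<close>

lemma funpow_eq_sum_binomial:
  fixes T :: "'v::comm_ring_1 \<Rightarrow> 'v"
  assumes add: "\<And>x y. T (x + y) = T x + T y"
  shows "(T ^^ n) x = (\<Sum>j\<le>n. of_nat (n choose j) * ((\<lambda>y. T y - y) ^^ j) x)"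
proof (induction n)
  case (Suc n)
  let ?y = "\<lambda>j. ((\<lambda>y. T y - y) ^^ j) x"
  have T0: "T 0 = 0" using add[of 0 0] by simp
  have T_mult: "T (of_nat k * z) = of_nat k * T z" for k z
    by (induction k) (simp_all only: of_nat_0 mult_zero_left T0 of_nat_Suc distrib_right mult_1_left add)
  have T_sum: "T (sum f A) = (\<Sum>j\<in>A. T (f j))" if "finite A" for f and A :: "nat set"
    using that by (induction A rule: finite_induct) (simp_all add: T0 add)
  have "(T ^^ Suc n) x = T (\<Sum>j\<le>n. of_nat (n choose j) * ?y j)"
    using Suc by simp
  also have "\<dots> = (\<Sum>j\<le>n. of_nat (n choose j) * T (?y j))"
    by (simp only: T_sum[OF finite_atMost] T_mult)
  also have "\<dots> = (\<Sum>j\<le>n. of_nat (n choose j) * (?y j + ?y (Suc j)))" by simp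
  also have "\<dots> = (\<Sum>j\<le>Suc n. of_nat (Suc n choose j) * ?y j)"
    using sum_pascal[of n ?y] .
  finally show ?case .
qed simp

text \<open>For \<open>q = p ^ m\<close> one has
  \<open>j * (q choose j) = q * ((q - 1) choose (j - 1))\<close>. If \<open>p\<close> did not divide
  the binomial coefficient, then \<open>q\<close> would divide \<open>j\<close>, although
  \<open>0 < j < q\<close>.\<close>

lemma prime_dvd_choose_prime_power:
  assumes "prime (p :: nat)" "0 < j" "j < p ^ m"
  shows "p dvd (p ^ m choose j)"
proof (rule ccontr)
  assume "\<not> p dvd (p ^ m choose j)"
  then have "coprime (p ^ m) (p ^ m choose j)"
    using assms(1) by (simp add: prime_imp_coprime)
  moreover have "j * (p ^ m choose j) = p ^ m * ((p ^ m - 1) choose (j - 1))"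
    using times_binomial_minus1_eq[of j "p ^ m"] assms by simp
  then have "p ^ m dvd j * (p ^ m choose j)" by simp
  ultimately have "p ^ m dvd j" by (simp add: coprime_dvd_mult_left_iff)
  then show False using assms dvd_imp_le[of "p ^ m" j] by simp
qed

lemma scaled_ivecs_iff:
  assumes "p > 0"
  shows "x \<in> (*) (of_nat p) ` ivecs R \<longleftrightarrow> x \<in> ivecs R \<and> (\<forall>i. int p dvd x i)"
proof
  assume "x \<in> (*) (of_nat p) ` ivecs R"
  then show "x \<in> ivecs R \<and> (\<forall>i. int p dvd x i)" by (auto simp: ivecs_def pointwise)
next
  assume x: "x \<in> ivecs R \<and> (\<forall>i. int p dvd x i)"
  then have "x = of_nat p * (\<lambda>i. x i div int p)" by (auto simp: fun_eq_iff pointwise)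
  moreover have "(\<lambda>i. x i div int p) \<in> ivecs R" using x by (auto simp: ivecs_def)
  ultimately show "x \<in> (*) (of_nat p) ` ivecs R" by blast
qed

lemma add_subgroup_sum:
  "add_subgroup H \<Longrightarrow> (\<And>j. j \<in> J \<Longrightarrow> f j \<in> H) \<Longrightarrow> sum f J \<in> H"
  by (induction J rule: infinite_finite_induct) (auto intro: add_subgroup_0 add_subgroup_add)

text \<open>Modulo \<open>p\<close>, \<open>(T - 1)\<^bsup>q\<^esup> = T\<^bsup>q\<^esup> - 1\<close> for a power \<open>q\<close> of \<open>p\<close>.\<close>

lemma funpow_diff_id_in_scaled:
  assumes "prime p" and add: "\<And>x y. T (x + y) = T x + T y" and V: "T ` ivecs R \<subseteq> ivecs R"
    and x: "x \<in> ivecs R" and per: "\<And>i. int p dvd (T ^^ (p ^ m)) x i - x i"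
  shows "((\<lambda>y. T y - y) ^^ (p ^ m)) x \<in> (*) (of_nat p) ` ivecs R"
proof -
  let ?pV = "(*) (of_nat p) ` ivecs R" and ?q = "p ^ m"
  let ?y = "\<lambda>j. ((\<lambda>y. T y - y) ^^ j) x"
  have pV: "add_subgroup ?pV" by (intro add_subgroup_scale add_subgroup_ivecs)
  have p0: "p > 0" using assms(1) by (rule prime_gt_0_nat)
  have y: "?y j \<in> ivecs R" for j
    using x V by (induction j) (auto intro: add_subgroup_diff[OF add_subgroup_ivecs])
  have "(T ^^ j) x \<in> ivecs R" for j
    using x V by (induction j) auto
  then have "(T ^^ ?q) x - x \<in> ivecs R"
    using add_subgroup_diff[OF add_subgroup_ivecs] x by blast
  then have Tq: "(T ^^ ?q) x - x \<in> ?pV"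
    using per by (simp add: scaled_ivecs_iff[OF p0] pointwise)
  have mid: "of_nat (?q choose j) * ?y j \<in> ?pV" if "j \<in> {0<..<?q}" for j
  proof -
    from that have "p dvd (?q choose j)"
      using prime_dvd_choose_prime_power[OF assms(1), of j m] by simp
    then obtain k where "?q choose j = p * k" by (rule dvdE)
    then have "of_nat (?q choose j) * ?y j = of_nat p * (of_nat k * ?y j)"
      by (simp only: of_nat_mult mult.assoc)
    then show ?thesis using add_subgroup_of_nat_mult[OF add_subgroup_ivecs y] by blast
  qed
  \<comment> \<open>The terms at \<open>j = 0\<close> and \<open>j = p ^ m\<close> are
    \<open>x\<close> and the power of \<open>T - 1\<close> in question; all the others lie in
    \<open>p V\<close>.\<close>
  have "{..?q} = insert 0 (insert ?q {0<..<?q})" using p0 by auto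
  then have "(T ^^ ?q) x = x + (?y ?q + (\<Sum>j\<in>{0<..<?q}. of_nat (?q choose j) * ?y j))"
    using p0 by (subst funpow_eq_sum_binomial[OF add]) simp
  then have "?y ?q = ((T ^^ ?q) x - x) - (\<Sum>j\<in>{0<..<?q}. of_nat (?q choose j) * ?y j)"
    by (simp only: algebra_simps)
  then show ?thesis
    using add_subgroup_diff[OF pV Tq add_subgroup_sum[OF pV mid]] by (simp only:)
qed

section \<open>The automaton of a periodic filtration\<close>

text \<open>The ring of functions has zero divisors, but nonzero constants can be cancelled
  coordinatewise.\<close>

lemma of_nat_fun_cancel:
  fixes x y :: "'a \<Rightarrow> int"
  assumes "of_nat c * x = of_nat c * y" "c > 0"
  shows "x = y"
proof
  fix i
  have "(of_nat c * x) i = (of_nat c * y) i" using assms(1) by simp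
  then show "x i = y i" using assms(2) by (simp add: pointwise)
qed

text \<open>One period of the chain. \<open>\<beta> n\<close> represents a generator of
  \<open>F n\<close> modulo \<open>F (Suc n)\<close>, the unit of the digits at position
  \<open>n\<close>.\<close>

locale lattice_chain =
  fixes p K R :: nat and T :: "ivec \<Rightarrow> ivec" and F :: "nat \<Rightarrow> ivec set" and \<beta> :: "nat \<Rightarrow> ivec"
  assumes prime_p: "prime p" and K_pos: "K > 0"
    and T_add: "\<And>x y. T (x + y) = T x + T y"
    and F_0: "F 0 = ivecs R" and F_K: "F K = (*) (of_nat p) ` ivecs R"
    and F_intermediate: "\<And>n. n \<le> K \<Longrightarrow> F n \<in> intermediate_subgroups p R"
    and F_step: "\<And>n. n < K \<Longrightarrow> filtration_step p T (F n) (F (Suc n)) (\<beta> n)"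
begin

lemma p_gt_1: "p > 1"
  using prime_p by (rule prime_gt_1_nat)

lemma T_diff: "T (x - y) = T x - T y"
  using T_add[of "x - y" y] by (simp add: algebra_simps)

lemma T_0: "T 0 = 0"
  using T_diff[of 0 0] by simp

lemma T_of_nat: "T (of_nat k * x) = of_nat k * T x"
  by (induction k) (simp_all add: T_0 T_add algebra_simps)

lemma F_subgroup: "n \<le> K \<Longrightarrow> add_subgroup (F n)"
  using F_intermediate by (auto simp: intermediate_subgroups_def)

lemma F_p: "n \<le> K \<Longrightarrow> x \<in> ivecs R \<Longrightarrow> of_nat p * x \<in> F n"
  using F_intermediate by (auto simp: intermediate_subgroups_def)

lemma F_ivecs: "n \<le> K \<Longrightarrow> x \<in> F n \<Longrightarrow> x \<in> ivecs R"
  using F_intermediate by (auto simp: intermediate_subgroups_def)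

lemma F_Suc_subset: "n < K \<Longrightarrow> F (Suc n) \<subseteq> F n"
  using F_step by (auto simp: filtration_step_def)

lemma F_T: "n < K \<Longrightarrow> x \<in> F n \<Longrightarrow> T x - x \<in> F (Suc n)"
  using F_step by (auto simp: filtration_step_def)

lemma \<beta>_in_F: "n < K \<Longrightarrow> \<beta> n \<in> F n"
  using F_step by (auto simp: filtration_step_def)

lemma F_digit: "n < K \<Longrightarrow> x \<in> F n \<Longrightarrow> \<exists>d<p. x - of_nat d * \<beta> n \<in> F (Suc n)"
  using F_step by (auto simp: filtration_step_def)

text \<open>Otherwise every multiple of \<open>\<beta> n\<close> would lie in
  \<open>F (Suc n)\<close>, and the digit condition would force \<open>F n = F (Suc n)\<close>,
  against properness.\<close>

lemma \<beta>_notin_F_Suc: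
  assumes "n < K"
  shows "\<beta> n \<notin> F (Suc n)"
proof
  assume b: "\<beta> n \<in> F (Suc n)"
  have s: "add_subgroup (F (Suc n))" using assms by (intro F_subgroup) auto
  have "x \<in> F (Suc n)" if "x \<in> F n" for x
  proof -
    from F_digit[OF assms that] obtain d where "x - of_nat d * \<beta> n \<in> F (Suc n)" by blast
    then show ?thesis
      using add_subgroup_diff_iff[OF s add_subgroup_of_nat_mult[OF s b, of d]] by simp
  qed
  then show False using F_step[OF assms] by (auto simp: filtration_step_def)
qed

text \<open>By Bezout: if \<open>k\<close> were prime to \<open>p\<close>, \<open>\<beta> n\<close>
  would be an integral combination of \<open>p \<beta> n\<close> and \<open>k \<beta> n\<close>,
  both in \<open>F (Suc n)\<close>. This makes digits below \<open>p\<close> unique.\<close>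

lemma \<beta>_multiple:
  assumes "n < K" "of_int k * \<beta> n \<in> F (Suc n)"
  shows "int p dvd k"
proof (rule ccontr)
  assume "\<not> int p dvd k"
  then have "coprime (int p) k" using prime_p by (intro prime_imp_coprime) auto
  then obtain u w where "u * int p + w * k = 1"
    using bezout_int[of "int p" k] by auto
  then have "of_int (u * int p + w * k) = (1 :: ivec)" by simp
  then have "(of_int u * of_nat p + of_int w * of_int k) * \<beta> n = \<beta> n"
    by simp
  then have eq: "\<beta> n = of_int u * (of_nat p * \<beta> n) + of_int w * (of_int k * \<beta> n)"
    by (simp add: algebra_simps)
  have s: "add_subgroup (F (Suc n))" using assms by (intro F_subgroup) auto
  have "of_nat p * \<beta> n \<in> F (Suc n)"
    using assms \<beta>_in_F F_ivecs[of n] by (intro F_p) auto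
  then have "of_int u * (of_nat p * \<beta> n) + of_int w * (of_int k * \<beta> n) \<in> F (Suc n)"
    by (intro add_subgroup_add[OF s] add_subgroup_of_int_mult[OF s] assms(2))
  then have "\<beta> n \<in> F (Suc n)" by (simp only: eq[symmetric])
  then show False using \<beta>_notin_F_Suc[OF assms(1)] by blast
qed

section \<open>The infinite chain of levels and digit expansions\<close>

definition level :: "nat \<Rightarrow> ivec set" where
  "level n = (*) (of_nat (p ^ (n div K))) ` F (n mod K)"

definition bvec :: "nat \<Rightarrow> ivec" where
  "bvec n = of_nat (p ^ (n div K)) * \<beta> (n mod K)"

lemma mod_K_less [simp]: "n mod K < K"
  using K_pos by simp

lemma level_eq_F: "n < K \<Longrightarrow> level n = F n"
  by (simp add: level_def)

lemma bvec_eq_\<beta>: "n < K \<Longrightarrow> bvec n = \<beta> n"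
  by (simp add: bvec_def)

text \<open>Spares a case distinction at the end of a period: there \<open>F (Suc (n mod K))\<close>
  is \<open>F K = p F 0\<close>, in agreement with position 0 of the next period.\<close>

lemma level_Suc: "level (Suc n) = (*) (of_nat (p ^ (n div K))) ` F (Suc (n mod K))"
proof (cases "Suc (n mod K) = K")
  case True
  then have "Suc n mod K = 0" "Suc n div K = Suc (n div K)"
    by (simp_all add: mod_Suc div_Suc)
  then show ?thesis
    by (simp add: level_def True F_K F_0 image_image algebra_simps)
next
  case False
  then have "Suc n mod K = Suc (n mod K)" "Suc n div K = n div K"
    by (simp_all add: mod_Suc div_Suc)
  then show ?thesis by (simp add: level_def)
qed

lemma level_add_K: "level (n + K) = (*) (of_nat p) ` level n"
  using K_pos by (simp add: level_def image_image algebra_simps)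

lemma bvec_add_K: "bvec (n + K) = of_nat p * bvec n"
  using K_pos by (simp add: bvec_def algebra_simps)

lemma level_subgroup: "add_subgroup (level n)"
  unfolding level_def by (intro add_subgroup_scale F_subgroup) (simp add: less_imp_le)

lemma level_Suc_subset: "level (Suc n) \<subseteq> level n"
  unfolding level_Suc unfolding level_def using F_Suc_subset[of "n mod K"] by auto

lemma level_antimono: "m \<le> n \<Longrightarrow> level n \<subseteq> level m"
  by (rule lift_Suc_antimono_le[of level]) (rule level_Suc_subset)

lemma level_T: "x \<in> level n \<Longrightarrow> T x - x \<in> level (Suc n)"
  unfolding level_Suc unfolding level_def
  using F_T[of "n mod K"] by (auto simp: T_of_nat simp flip: right_diff_distrib simp del: of_nat_power)

lemma T_level: "x \<in> level n \<Longrightarrow> T x \<in> level n"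
  using level_T[of x n] level_Suc_subset[of n] add_subgroup_diff_iff[OF level_subgroup, of x n "T x"] by blast

lemma bvec_in_level: "bvec n \<in> level n"
  using \<beta>_in_F[of "n mod K"] by (auto simp: bvec_def level_def)

lemma bvec_multiple:
  assumes "of_int k * bvec n \<in> level (Suc n)"
  shows "int p dvd k"
proof -
  obtain x where x: "x \<in> F (Suc (n mod K))" "of_int k * bvec n = of_nat (p ^ (n div K)) * x"
    using assms unfolding level_Suc by blast
  then have "of_nat (p ^ (n div K)) * (of_int k * \<beta> (n mod K)) = of_nat (p ^ (n div K)) * x"
    by (simp add: bvec_def algebra_simps)
  then have "of_int k * \<beta> (n mod K) = x"
    by (rule of_nat_fun_cancel) (use p_gt_1 in simp)
  then show ?thesis using x \<beta>_multiple[of "n mod K" k] by simp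
qed

text \<open>The level is chosen by the entry itself: in
  \<open>level (nat \<bar>x i\<bar> * K)\<close> all entries are multiples of
  \<open>p ^ nat \<bar>x i\<bar>\<close>, which exceeds \<open>\<bar>x i\<bar>\<close>.\<close>

lemma level_Inter:
  assumes "\<And>n. x \<in> level n"
  shows "x = 0"
proof
  fix i
  have "x \<in> level (nat \<bar>x i\<bar> * K)" by (rule assms)
  then obtain y where "x = of_nat (p ^ nat \<bar>x i\<bar>) * y"
    using K_pos by (auto simp: level_def)
  then have "x i = (of_nat (p ^ nat \<bar>x i\<bar>) * y) i" by simp
  then have "int (p ^ nat \<bar>x i\<bar>) dvd x i"
    by (simp only: pointwise) (metis dvd_triv_left)
  moreover have "\<bar>x i\<bar> < int (p ^ nat \<bar>x i\<bar>)"
  proof -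
    have "nat \<bar>x i\<bar> < p ^ nat \<bar>x i\<bar>" using p_gt_1 by (simp add: power_gt_expt)
    then show ?thesis by linarith
  qed
  ultimately show "x i = 0 i"
    by (metis abs_of_nat dvd_imp_le_int not_le pointwise(5))
qed

text \<open>Words are digit strings with respect to \<open>bvec n\<close>,
  \<open>bvec (Suc n)\<close> and so on, leading digit first. Read from position 0, a word of length
  \<open>l\<close> stands for a coset of \<open>level l\<close>.\<close>

primrec val :: "nat \<Rightarrow> nat list \<Rightarrow> ivec" where
  "val n [] = 0"
| "val n (x # w) = of_nat x * bvec n + val (Suc n) w"

lemma val_in_level: "val n w \<in> level n"
proof (induction w arbitrary: n)
  case (Cons x w)
  have "val (Suc n) w \<in> level n" using Cons level_Suc_subset by blast
  then show ?case
    by (auto intro!: add_subgroup_add[OF level_subgroup] add_subgroup_of_nat_mult[OF level_subgroup] bvec_in_level)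
qed (simp add: add_subgroup_0[OF level_subgroup])

lemma val_add_K: "val (n + K) w = of_nat p * val n w"
proof (induction w arbitrary: n)
  case (Cons x w)
  then show ?case using Cons[of "Suc n"] bvec_add_K[of n] by (simp add: algebra_simps)
qed simp

lemma val_replicate_0: "val n (replicate k 0) = 0"
  by (induction k arbitrary: n) auto

text \<open>Modulo \<open>level (Suc n)\<close> only the leading digits remain, and
  \<open>bvec_multiple\<close> shows that these are congruent modulo \<open>p\<close>, hence
  equal.\<close>

lemma val_inj:
  assumes "w \<in> lists {..<p}" "w' \<in> lists {..<p}" "length w' = length w"
    and "val n w - val n w' \<in> level (n + length w)"
  shows "w = w'"
  using assms
proof (induction w arbitrary: w' n)
  case (Cons x w)
  then obtain y u where w': "w' = y # u" by (cases w') auto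
  have lt: "x < p" "y < p" using Cons.hyps Cons.prems w' by auto
  let ?d = "val (Suc n) w - val (Suc n) u"
  have d: "?d \<in> level (Suc n)" by (intro add_subgroup_diff[OF level_subgroup] val_in_level)
  have e: "of_int (int x - int y) * bvec n + ?d \<in> level (Suc n + length w)"
    using Cons.prems by (simp add: w' algebra_simps)
  then have "of_int (int x - int y) * bvec n + ?d \<in> level (Suc n)"
    using level_antimono[of "Suc n" "Suc n + length w"] by auto
  then have "of_int (int x - int y) * bvec n \<in> level (Suc n)"
    using add_subgroup_add_iff[OF level_subgroup d] by blast
  then have "int p dvd int x - int y" by (rule bvec_multiple)
  then have "x = y"
    using lt by (metis mod_eq_dvd_iff mod_less of_nat_eq_iff zmod_int)
  moreover have "w = u"
    using Cons.prems e \<open>x = y\<close> w' by (intro Cons.IH[of u "Suc n"]) auto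
  ultimately show ?case by (simp add: w')
qed simp

section \<open>States, transitions and correctness of the automaton\<close>

definition digit :: "nat \<Rightarrow> ivec \<Rightarrow> nat" where
  "digit n v = (SOME d. d < p \<and> v - of_nat d * \<beta> n \<in> F (Suc n))"

lemma digit: "n < K \<Longrightarrow> v \<in> F n \<Longrightarrow> v - of_nat (digit n v) * \<beta> n \<in> F (Suc n)"
  unfolding digit_def using someI_ex[OF F_digit] by blast

definition lin :: "bool \<Rightarrow> ivec \<Rightarrow> ivec" where
  "lin c = (if c then T else id)"

text \<open>The state \<open>(c, n, v)\<close> performs \<open>x \<mapsto> lin c x + v\<close> on \<open>F n\<close>.  Splitting off the leading
  digit of \<open>x\<close> leaves such a map on \<open>F (Suc n)\<close>, and \<open>F K = p F 0\<close> makes the levels periodic.\<close>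

definition chain_out :: "bool \<times> nat \<times> ivec \<Rightarrow> nat \<Rightarrow> nat" where
  "chain_out = (\<lambda>(c, n, v) x. (x + digit n v) mod p)"

text \<open>With output letter \<open>e\<close> and rest \<open>u\<close>, additivity gives
  \<open>lin c (of_nat x * \<beta> n + y) + v = of_nat e * \<beta> n + (lin c y + u)\<close>: the
  rest is the translation part of the map on what follows the leading digit.\<close>

definition chain_rest :: "bool \<times> nat \<times> ivec \<Rightarrow> nat \<Rightarrow> ivec" where
  "chain_rest = (\<lambda>(c, n, v) x. of_nat x * lin c (\<beta> n) + v - of_nat (chain_out (c, n, v) x) * \<beta> n)"

definition chain_next :: "bool \<times> nat \<times> ivec \<Rightarrow> nat \<Rightarrow> bool \<times> nat \<times> ivec" where
  "chain_next = (\<lambda>(c, n, v) x. if Suc n < K then (c, Suc n, chain_rest (c, n, v) x)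
     else (c, 0, \<lambda>i. chain_rest (c, n, v) x i div int p))"

text \<open>Bounds what one transition can add to an entry of the translation part. The sum
  majorises each entry of \<open>\<beta> n\<close> and of \<open>T (\<beta> n)\<close>, the factor
  \<open>p\<close> the digits, and the factor 2 serves the two terms; the summand 1 makes room for
  the unit vectors as initial states.\<close>

definition growth :: int where
  "growth = 2 * int p * (\<Sum>n<K. \<Sum>i<R. \<bar>\<beta> n i\<bar> + \<bar>T (\<beta> n) i\<bar>) + 1"

text \<open>The bound grows by \<open>growth\<close> per position, up to
  \<open>2 * growth * K\<close> at the end of a period, where division by \<open>p \<ge> 2\<close>
  brings it back to \<open>growth * K\<close>. This makes the set finite and closed under
  transitions.\<close>

definition chain_states :: "(bool \<times> nat \<times> ivec) set" where
  "chain_states = {(c, n, v). n < K \<and> v \<in> F n \<and> (\<forall>i. \<bar>v i\<bar> \<le> growth * int (K + n))}"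

definition chain_automaton :: "(bool \<times> nat \<times> ivec, nat) automaton" where
  "chain_automaton = \<lparr>states = chain_states, alphabet = {..<p}, trans_fn = chain_next, out_fn = chain_out\<rparr>"

lemma growth_pos: "growth \<ge> 1"
  unfolding growth_def by (auto intro!: sum_nonneg mult_nonneg_nonneg)

lemma lin_add: "lin c (x + y) = lin c x + lin c y"
  by (simp add: lin_def T_add)

lemma lin_of_nat: "lin c (of_nat k * x) = of_nat k * lin c x"
  by (simp add: lin_def T_of_nat)

lemma lin_level: "x \<in> level n \<Longrightarrow> lin c x \<in> level n"
  by (simp add: lin_def T_level)

lemma lin_\<beta>: "n < K \<Longrightarrow> lin c (\<beta> n) - \<beta> n \<in> F (Suc n)"
  by (simp add: lin_def F_T \<beta>_in_F add_subgroup_0[OF F_subgroup])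

text \<open>With \<open>d\<close> the digit of \<open>v\<close> and \<open>x + d = e + p q\<close>
  for the output letter \<open>e\<close>, the rest is \<open>x (lin c (\<beta> n) - \<beta> n) + (v
  - d \<beta> n) + q (p \<beta> n)\<close>. The first summand lies in \<open>F (Suc n)\<close> since
  \<open>T\<close> is trivial on the quotient, the second by choice of the digit, the third since
  \<open>p V \<subseteq> F (Suc n)\<close>.\<close>

lemma chain_rest_in_F:
  assumes "n < K" "v \<in> F n"
  shows "chain_rest (c, n, v) x \<in> F (Suc n)"
proof -
  define d where "d = digit n v"
  define q where "q = (x + d) div p"
  have s: "add_subgroup (F (Suc n))" using assms by (intro F_subgroup) auto
  have "x + d = (x + d) mod p + p * q" by (simp add: q_def)
  then have "(of_nat (x + d) :: ivec) = of_nat ((x + d) mod p) + of_nat p * of_nat q"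
    by (metis of_nat_add of_nat_mult)
  then have "(of_nat ((x + d) mod p) :: ivec) = of_nat x + of_nat d - of_nat p * of_nat q"
    by simp
  then have "of_nat (chain_out (c, n, v) x) * \<beta> n = (of_nat x + of_nat d - of_nat p * of_nat q) * \<beta> n"
    by (simp add: chain_out_def d_def)
  then have "chain_rest (c, n, v) x =
      of_nat x * (lin c (\<beta> n) - \<beta> n) + (v - of_nat d * \<beta> n) + of_nat q * (of_nat p * \<beta> n)"
    by (simp add: chain_rest_def algebra_simps)
  moreover have "of_nat p * \<beta> n \<in> F (Suc n)"
    using assms \<beta>_in_F F_ivecs[of n] by (intro F_p) auto
  ultimately show ?thesis
    using lin_\<beta>[OF assms(1)] digit[OF assms]
    by (auto intro!: add_subgroup_add[OF s] add_subgroup_of_nat_mult[OF s] simp: d_def)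
qed

lemma abs_entry_le:
  assumes "n < K"
  shows "2 * int p * \<bar>\<beta> n i\<bar> \<le> growth - 1" "2 * int p * \<bar>lin c (\<beta> n) i\<bar> \<le> growth - 1"
proof -
  have "T (\<beta> n) - \<beta> n \<in> ivecs R" "\<beta> n \<in> ivecs R"
    using assms F_T[OF assms \<beta>_in_F[OF assms]] \<beta>_in_F[OF assms]
    by (auto intro: F_ivecs[of n] F_ivecs[of "Suc n"])
  then have z: "\<beta> n i = 0" "T (\<beta> n) i = 0" if "i \<ge> R"
    using that by (auto simp: ivecs_def pointwise)
  have "\<bar>\<beta> n i\<bar> + \<bar>T (\<beta> n) i\<bar> \<le> (\<Sum>n<K. \<Sum>i<R. \<bar>\<beta> n i\<bar> + \<bar>T (\<beta> n) i\<bar>)"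
  proof (cases "i < R")
    case True
    then have "\<bar>\<beta> n i\<bar> + \<bar>T (\<beta> n) i\<bar> \<le> (\<Sum>i<R. \<bar>\<beta> n i\<bar> + \<bar>T (\<beta> n) i\<bar>)"
      by (intro member_le_sum) auto
    also have "\<dots> \<le> (\<Sum>n<K. \<Sum>i<R. \<bar>\<beta> n i\<bar> + \<bar>T (\<beta> n) i\<bar>)"
      using assms by (intro member_le_sum) (auto intro!: sum_nonneg)
    finally show ?thesis .
  qed (auto simp: z intro!: sum_nonneg)
  then have "2 * int p * (\<bar>\<beta> n i\<bar> + \<bar>T (\<beta> n) i\<bar>) \<le> growth - 1"
    unfolding growth_def by (simp add: mult_left_mono)
  then have "2 * int p * \<bar>\<beta> n i\<bar> + 2 * int p * \<bar>T (\<beta> n) i\<bar> \<le> growth - 1"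
    by (simp only: distrib_left)
  moreover have "2 * int p * \<bar>\<beta> n i\<bar> \<ge> 0" "2 * int p * \<bar>T (\<beta> n) i\<bar> \<ge> 0" by simp_all
  ultimately have "2 * int p * \<bar>\<beta> n i\<bar> \<le> growth - 1" "2 * int p * \<bar>T (\<beta> n) i\<bar> \<le> growth - 1"
    by linarith+
  then show "2 * int p * \<bar>\<beta> n i\<bar> \<le> growth - 1" "2 * int p * \<bar>lin c (\<beta> n) i\<bar> \<le> growth - 1"
    by (simp_all add: lin_def)
qed

lemma chain_out_less: "chain_out s x < p"
  using p_gt_1 by (simp add: chain_out_def split: prod.split)

lemma abs_chain_rest_le:
  assumes "n < K" "x < p"
  shows "\<bar>chain_rest (c, n, v) x i\<bar> \<le> \<bar>v i\<bar> + growth"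
proof -
  let ?e = "chain_out (c, n, v) x"
  have "\<bar>int x * lin c (\<beta> n) i\<bar> \<le> int p * \<bar>lin c (\<beta> n) i\<bar>" "\<bar>int ?e * \<beta> n i\<bar> \<le> int p * \<bar>\<beta> n i\<bar>"
    using assms(2) chain_out_less[of "(c, n, v)" x] by (simp_all add: abs_mult mult_right_mono)
  moreover have "chain_rest (c, n, v) x i = int x * lin c (\<beta> n) i + v i - int ?e * \<beta> n i"
    by (simp add: chain_rest_def pointwise)
  ultimately show ?thesis
    using abs_entry_le(1)[OF assms(1), of i] abs_entry_le(2)[OF assms(1), of c i]
    by (simp only: mult.assoc)
qed

text \<open>At the end of a period the rest lies in \<open>F K = p V\<close>, so \<open>div\<close>
  is exact here.\<close>

lemma chain_rest_last:
  assumes "Suc n = K" "v \<in> F n"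
  shows "of_nat p * (\<lambda>i. chain_rest (c, n, v) x i div int p) = chain_rest (c, n, v) x"
    and "(\<lambda>i. chain_rest (c, n, v) x i div int p) \<in> F 0"
proof -
  obtain y where y: "y \<in> ivecs R" "chain_rest (c, n, v) x = of_nat p * y"
    using chain_rest_in_F[of n v c x] assms F_K by auto
  have "(\<lambda>i. chain_rest (c, n, v) x i div int p) = y"
    unfolding y(2) using p_gt_1 by (auto simp: fun_eq_iff pointwise)
  then show "of_nat p * (\<lambda>i. chain_rest (c, n, v) x i div int p) = chain_rest (c, n, v) x"
    and "(\<lambda>i. chain_rest (c, n, v) x i div int p) \<in> F 0"
    using y by (simp_all add: F_0)
qed

lemma chain_next_in_states:
  assumes "s \<in> chain_states" "x < p"
  shows "chain_next s x \<in> chain_states"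
proof -
  obtain c n v where s: "s = (c, n, v)" by (cases s)
  have n: "n < K" "v \<in> F n" "\<And>i. \<bar>v i\<bar> \<le> growth * int (K + n)"
    using assms(1) by (auto simp: s chain_states_def)
  have le: "\<bar>chain_rest (c, n, v) x i\<bar> \<le> growth * int (K + Suc n)" for i
    using abs_chain_rest_le[OF n(1) assms(2), of c v i] n(3)[of i] by (simp add: algebra_simps)
  show ?thesis
  proof (cases "Suc n < K")
    case True
    then show ?thesis
      using chain_rest_in_F[OF n(1,2)] le by (simp add: s chain_next_def chain_states_def add_ac)
  next
    case False
    then have K: "Suc n = K" using n by simp
    have "\<bar>chain_rest (c, n, v) x i div int p\<bar> \<le> growth * int K" for i
    proof -
      have "int p * (chain_rest (c, n, v) x i div int p) = chain_rest (c, n, v) x i"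
        using fun_cong[OF chain_rest_last(1)[OF K n(2), of c x], of i] by (simp add: pointwise)
      then have "int p * \<bar>chain_rest (c, n, v) x i div int p\<bar> = \<bar>chain_rest (c, n, v) x i\<bar>"
        by (metis abs_mult abs_of_nat)
      also have "\<dots> \<le> 2 * (growth * int K)"
        using le[of i] by (simp add: K algebra_simps)
      finally have "int p * \<bar>chain_rest (c, n, v) x i div int p\<bar> \<le> 2 * (growth * int K)" .
      \<comment> \<open>\<open>p \<ge> 2\<close> undoes the doubling of the bound over a
        period.\<close>
      moreover have "2 * \<bar>chain_rest (c, n, v) x i div int p\<bar> \<le> int p * \<bar>chain_rest (c, n, v) x i div int p\<bar>"
        using p_gt_1 by (intro mult_right_mono) auto
      ultimately show ?thesis by linarith
    qed
    then show ?thesis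
      using False K_pos chain_rest_last(2)[OF K n(2)] by (simp add: s chain_next_def chain_states_def)
  qed
qed

lemma finite_chain_states: "finite chain_states"
proof -
  define N where "N = growth * int (K + K)"
  define E where "E = {v :: ivec. \<forall>i. (i \<in> {..<R} \<longrightarrow> v i \<in> {-N..N}) \<and> (i \<notin> {..<R} \<longrightarrow> v i = 0)}"
  have "finite E" unfolding E_def by (intro finite_set_of_finite_funs) auto
  moreover have "chain_states \<subseteq> UNIV \<times> {..<K} \<times> E"
  proof
    fix s assume "s \<in> chain_states"
    then obtain c n v where s: "s = (c, n, v)" "n < K" "v \<in> F n" "\<And>i. \<bar>v i\<bar> \<le> growth * int (K + n)"
      by (auto simp: chain_states_def)
    have "growth * int (K + n) \<le> N"
      unfolding N_def using growth_pos s(2) by (intro mult_left_mono) auto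
    then have "\<bar>v i\<bar> \<le> N" for i using s(4)[of i] by linarith
    then have "v i \<in> {-N..N}" for i by (simp add: abs_le_iff minus_le_iff)
    moreover have "v \<in> ivecs R" using s F_ivecs[of n v] by auto
    ultimately show "s \<in> UNIV \<times> {..<K} \<times> E"
      using s by (auto simp: E_def ivecs_def)
  qed
  ultimately show ?thesis
    by (meson finite_SigmaI finite_UNIV finite_lessThan finite_subset)
qed

text \<open>Correctness of the automaton, by splitting off leading digits: on digit strings from
  position \<open>n\<close>, the state \<open>(c, n, v)\<close> induces the map
  \<open>x \<mapsto> lin c x + v\<close>.\<close>

lemma out_word_chain_automaton:
  assumes "(c, n, v) \<in> chain_states" "w \<in> lists {..<p}"
  shows "val n (out_word chain_automaton (c, n, v) w) - (lin c (val n w) + v) \<in> level (n + length w)"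
  using assms
proof (induction w arbitrary: n v)
  case Nil
  then have "v \<in> level n" by (auto simp: chain_states_def level_eq_F)
  then show ?case
    using add_subgroup_uminus[OF level_subgroup] by (simp add: lin_def T_0)
next
  case (Cons x w)
  define e where "e = chain_out (c, n, v) x"
  define u where "u = chain_rest (c, n, v) x"
  have n: "n < K" "v \<in> F n" using Cons.prems by (auto simp: chain_states_def)
  have x: "x < p" "w \<in> lists {..<p}" using Cons.prems by auto
  have next_in: "chain_next (c, n, v) x \<in> chain_states"
    using chain_next_in_states Cons.prems x by simp
  have u: "of_nat x * lin c (\<beta> n) + v = of_nat e * \<beta> n + u"
    by (simp add: u_def e_def chain_rest_def)
  define w' where "w' = out_word chain_automaton (chain_next (c, n, v) x) w"
  have out: "out_word chain_automaton (c, n, v) (x # w) = e # w'"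
    by (simp add: w'_def e_def chain_automaton_def)
  have "val (Suc n) w' - (lin c (val (Suc n) w) + u) \<in> level (Suc n + length w)"
  proof (cases "Suc n < K")
    case True
    then have "chain_next (c, n, v) x = (c, Suc n, u)" by (simp add: chain_next_def u_def)
    then show ?thesis using Cons.IH[of "Suc n" u] next_in x(2) by (simp add: w'_def)
  next
    case False
    then have K: "Suc n = K" using n by simp
    define u' where "u' = (\<lambda>i. u i div int p)"
    have u': "of_nat p * u' = u"
      unfolding u'_def u_def by (rule chain_rest_last(1)[OF K n(2)])
    have nx: "chain_next (c, n, v) x = (c, 0, u')" using False by (simp add: chain_next_def u_def u'_def)
    \<comment> \<open>The next state sits at position 0 of a new period; multiplying the induction
      hypothesis by \<open>p\<close> shifts it to position \<open>K\<close>.\<close>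
    have "val 0 w' - (lin c (val 0 w) + u') \<in> level (0 + length w)"
      using Cons.IH[of 0 u'] next_in x(2) by (simp add: w'_def nx)
    then have "of_nat p * (val 0 w' - (lin c (val 0 w) + u')) \<in> level (length w + K)"
      unfolding level_add_K by simp
    moreover have "of_nat p * (val 0 w' - (lin c (val 0 w) + u')) =
        val (0 + K) w' - (lin c (val (0 + K) w) + u)"
      by (simp only: val_add_K lin_of_nat) (simp add: algebra_simps flip: u')
    ultimately show ?thesis by (simp add: K add.commute)
  qed
  moreover have "val n (e # w') - (lin c (val n (x # w)) + v) = val (Suc n) w' - (lin c (val (Suc n) w) + u)"
    using u n by (simp add: bvec_eq_\<beta> lin_add lin_of_nat algebra_simps)
  ultimately show ?case by (simp only: out list.size add_Suc add_Suc_right add_0_right)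
qed

end

text \<open>The cycle is the shift by one modulo \<open>n\<close>, so that adding a fixed digit is a
  power of it.\<close>

lemma cycle_of_list_upt:
  assumes "x < n"
  shows "(cycle_of_list [0..<n] ^^ k) x = (x + k) mod n"
proof -
  have "map (cycle_of_list [0..<n] ^^ k) [0..<n] = rotate k [0..<n]"
    by (rule cyclic_rotation) simp
  then have "map (cycle_of_list [0..<n] ^^ k) [0..<n] ! x = rotate k [0..<n] ! x" by simp
  then show ?thesis using assms by (simp add: nth_rotate add.commute)
qed

lemma (in lattice_chain) p_automaton_chain_automaton: "p_automaton p chain_automaton"
proof -
  \<comment> \<open>The identity map at position 0 witnesses that the set of states is not
    empty.\<close>
  have "(False, 0, 0) \<in> chain_states"
    using K_pos growth_pos add_subgroup_0[OF F_subgroup, of 0] by (simp add: chain_states_def pointwise)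
  then have "finite_automaton chain_automaton"
    using p_gt_1 finite_chain_states chain_next_in_states chain_out_less
    by (auto simp: finite_automaton_def chain_automaton_def)
  moreover have rot: "\<exists>k. \<forall>x\<in>{..<p}. chain_out s x = (cycle_of_list [0..<p] ^^ k) x" for s
    by (auto simp: chain_out_def cycle_of_list_upt split: prod.split)
  moreover have "permutational chain_automaton"
    unfolding permutational_def
  proof
    fix s
    obtain k where k: "\<And>x. x < p \<Longrightarrow> chain_out s x = (cycle_of_list [0..<p] ^^ k) x"
      using rot[of s] by auto
    have "(cycle_of_list [0..<p] ^^ k) permutes set [0..<p]"
      by (intro permutes_funpow cycle_permutes)
    then have "bij_betw (cycle_of_list [0..<p] ^^ k) {..<p} {..<p}"
      using permutes_imp_bij by (fastforce simp: atLeast0LessThan)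
    then show "bij_betw (out_fn chain_automaton s) (alphabet chain_automaton) (alphabet chain_automaton)"
      using k bij_betw_cong[of "{..<p}" "chain_out s"] by (simp add: chain_automaton_def)
  qed
  ultimately show ?thesis
    by (auto simp: p_automaton_def chain_automaton_def atLeast0LessThan intro!: exI[of _ "[0..<p]"])
qed

section \<open>Automaton groups are residually \<open>p\<close>-finite\<close>

lemma length_out_word [simp]: "length (out_word A q w) = length w"
  by (induction w arbitrary: q) auto

text \<open>States are renamed along an injection into the natural numbers, as
  \<open>generated_by_finite_p_automaton\<close> asks for states of type \<open>nat\<close>.\<close>

lemma p_automaton_nat_states:
  fixes A :: "('q, 'x) automaton"
  assumes A: "p_automaton p A" and S: "S \<subseteq> states A"
  obtains A' :: "(nat, 'x) automaton" and S' where "p_automaton p A'" "S' \<subseteq> states A'"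
    "alphabet A' = alphabet A" "autom_perm A' ` S' = autom_perm A ` S"
proof -
  have fin: "finite_automaton A" using A by (simp add: p_automaton_def)
  then have "finite (states A)" by (simp add: finite_automaton_def)
  then obtain e :: "'q \<Rightarrow> nat" where e: "inj_on e (states A)"
    using finite_imp_inj_to_nat_seg by blast
  define d where "d = inv_into (states A) e"
  have d: "d (e q) = q" if "q \<in> states A" for q
    using e that by (simp add: d_def)
  define A' where "A' = \<lparr>states = e ` states A, alphabet = alphabet A,
    trans_fn = \<lambda>q x. e (trans_fn A (d q) x), out_fn = \<lambda>q. out_fn A (d q)\<rparr>"
  have "p_automaton p A'"
    using A by (auto simp: p_automaton_def finite_automaton_def permutational_def A'_def d)
  moreover have out: "out_word A' (e q) w = out_word A q w"
    if "q \<in> states A" "w \<in> lists (alphabet A)" for q w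
    using that
  proof (induction w arbitrary: q)
    case (Cons x w)
    then have "trans_fn A q x \<in> states A" using fin by (auto simp: finite_automaton_def)
    then show ?case using Cons by (simp add: A'_def d)
  qed simp
  have "autom_perm A' (e q) = autom_perm A q" if "q \<in> states A" for q
    using out[OF that] by (auto simp: autom_perm_def A'_def restrict_def fun_eq_iff)
  then have "autom_perm A' ` (e ` S) = autom_perm A ` S"
    using S by (auto simp: image_image subset_iff intro!: image_cong)
  ultimately show thesis
    using S by (intro that[of A' "e ` S"]) (auto simp: A'_def)
qed

text \<open>If a prime \<open>l\<close> other than \<open>p\<close> divided the order, a
  non-identity element of a subgroup of order \<open>l\<close> would have order dividing both
  \<open>l\<close> and a power of \<open>p\<close>.\<close>

lemma order_prime_power_if_exponent:
  fixes P :: "('a, 'b) monoid_scheme"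
  assumes "group P" "finite (carrier P)" "prime p"
    and exp: "\<And>x. x \<in> carrier P \<Longrightarrow> \<exists>a. x [^]\<^bsub>P\<^esub> (p ^ a :: nat) = \<one>\<^bsub>P\<^esub>"
  shows "\<exists>n. order P = p ^ n"
proof -
  interpret group P by fact
  have "order P > 0" using assms(2) by (simp add: order_gt_0_iff_finite)
  then obtain n k where nk: "order P = p ^ n * k" "\<not> p dvd k"
    using multiplicity_decompose'[of "order P" p] assms(3) by (metis neq0_conv not_prime_unit)
  have "k = 1"
  proof (rule ccontr)
    assume "k \<noteq> 1"
    then obtain l where l: "prime l" "l dvd k" using prime_factor_nat by blast
    then obtain k' where "order P = l ^ 1 * k'" using nk(1) by (metis dvd_def dvd_mult power_one_right)
    \<comment> \<open>Sylow's theorem with exponent 1 acts as Cauchy's theorem.\<close>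
    then obtain K where K: "subgroup K P" "card K = l"
      using sylow_thm[OF l(1) assms(1), of 1 k'] assms(2) by auto
    have "l > 1" using l(1) by (rule prime_gt_1_nat)
    then obtain x where x: "x \<in> K" "x \<noteq> \<one>\<^bsub>P\<^esub>"
      using K by (metis card_1_singleton_iff card_le_Suc0_iff_eq card.infinite One_nat_def
          less_irrefl_nat not_less not_one_le_zero order_le_less subgroup.one_closed)
    have xP: "x \<in> carrier P" using K(1) x(1) by (rule subgroup.mem_carrier)
    have "x [^]\<^bsub>P\<^esub> l = \<one>\<^bsub>P\<^esub>"
      using group.pow_order_eq_1[OF subgroup_imp_group[OF K(1)], of x] x K
      by (simp add: order_def nat_pow_consistent[symmetric])
    then have "ord x dvd l" using xP by (simp add: pow_eq_id)
    moreover obtain a where "x [^]\<^bsub>P\<^esub> (p ^ a) = \<one>\<^bsub>P\<^esub>" using exp[OF xP] by blast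
    then have "ord x dvd p ^ a" using xP by (simp add: pow_eq_id)
    moreover have "coprime l (p ^ a)"
      using l nk(2) assms(3) by (metis coprime_power_right_iff primes_coprime)
    ultimately have "ord x = 1" by (metis coprime_common_divisor_nat)
    then show False using x xP by (metis ord_eq_1)
  qed
  then show ?thesis using nk by auto
qed

text \<open>Residual finiteness is stated with target groups on \<open>nat\<close>; the structure is
  carried over along an injection.\<close>

lemma finite_group_iso_nat:
  fixes P :: "('a, 'b) monoid_scheme"
  assumes "group P" "finite (carrier P)"
  obtains H :: "nat monoid" and e where "group H" "finite (carrier H)" "order H = order P" "e \<in> iso P H"
proof -
  interpret group P by fact
  obtain e :: "'a \<Rightarrow> nat" where e: "inj_on e (carrier P)"
    using finite_imp_inj_to_nat_seg[OF assms(2)] by blast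
  define d where "d = inv_into (carrier P) e"
  have d: "d (e x) = x" if "x \<in> carrier P" for x using e that by (simp add: d_def)
  define H where "H = \<lparr>carrier = e ` carrier P, mult = \<lambda>x y. e (d x \<otimes>\<^bsub>P\<^esub> d y), one = e \<one>\<^bsub>P\<^esub>\<rparr>"
  have hom: "e \<in> hom P H" by (auto simp: hom_def H_def d)
  have "group H"
    using hom_imp_img_group[OF hom] by (simp add: H_def)
  moreover have "e \<in> iso P H"
    using hom e by (simp add: iso_def bij_betw_def H_def)
  moreover have "finite (carrier H)" "order H = order P"
    using assms(2) e by (simp_all add: H_def order_def card_image)
  ultimately show thesis using that by blast
qed

section \<open>Tree automorphisms with cyclic local action\<close>

text \<open>For a cycle of length \<open>p\<close> this is the infinitely iterated wreath product of
  cyclic groups of order \<open>p\<close>, acting on the rooted tree of words; the exponent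
  \<open>k\<close> may vary with the vertex \<open>w\<close>.\<close>

definition cyclic_tree_perms :: "'x list \<Rightarrow> ('x list \<Rightarrow> 'x list) set" where
  "cyclic_tree_perms cs = {f \<in> carrier (BijGroup (lists (set cs))). \<forall>w\<in>lists (set cs).
     length (f w) = length w \<and> (\<exists>k. \<forall>x\<in>set cs. f (w @ [x]) = f w @ [(cycle_of_list cs ^^ k) x])}"

lemma cycle_of_list_funpow_in: "x \<in> set cs \<Longrightarrow> (cycle_of_list cs ^^ k) x \<in> set cs"
  by (simp add: permutes_in_image[OF permutes_funpow[OF cycle_permutes]])

lemma cycle_of_list_funpow_mult_length:
  assumes "cycle cs" "x \<in> set cs"
  shows "(cycle_of_list cs ^^ (length cs * k)) x = x"
proof -
  have eq: "map (cycle_of_list cs ^^ (length cs * k)) cs = cs"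
    using cyclic_rotation[OF assms(1)] rotate_conv_mod[of "length cs * k" cs] by (simp only:) simp
  obtain i where i: "i < length cs" "cs ! i = x" using assms(2) by (auto simp: in_set_conv_nth)
  then show ?thesis using arg_cong[OF eq, of "\<lambda>xs. xs ! i"] by simp
qed

lemma BijGroup_mult_apply:
  "f \<in> carrier (BijGroup S) \<Longrightarrow> g \<in> carrier (BijGroup S) \<Longrightarrow> x \<in> S \<Longrightarrow> (f \<otimes>\<^bsub>BijGroup S\<^esub> g) x = f (g x)"
  by (simp add: BijGroup_def compose_eq)

lemma BijGroup_one_apply: "x \<in> S \<Longrightarrow> \<one>\<^bsub>BijGroup S\<^esub> x = x"
  by (simp add: BijGroup_def)

lemma BijGroup_apply_in: "f \<in> carrier (BijGroup S) \<Longrightarrow> x \<in> S \<Longrightarrow> f x \<in> S"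
  using Bij_imp_funcset[of f S] unfolding BijGroup_def by auto

lemma BijGroup_eqI:
  assumes "f \<in> carrier (BijGroup S)" "g \<in> carrier (BijGroup S)" "\<And>x. x \<in> S \<Longrightarrow> f x = g x"
  shows "f = g"
  using assms Bij_imp_extensional by (intro extensionalityI[of f S]) (auto simp: BijGroup_def)

lemma BijGroup_pow_apply:
  assumes "f \<in> carrier (BijGroup S)" "x \<in> S"
  shows "(f [^]\<^bsub>BijGroup S\<^esub> (n :: nat)) x = (f ^^ n) x"
  using assms(2)
proof (induction n arbitrary: x)
  case 0
  then show ?case by (simp add: BijGroup_one_apply)
next
  case (Suc n)
  interpret group "BijGroup S" by (rule group_BijGroup)
  show ?case
    using Suc assms(1) BijGroup_apply_in[OF assms(1) Suc.prems]
    by (simp add: BijGroup_mult_apply funpow_swap1)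
qed

lemma cyclic_tree_permsI:
  assumes "f \<in> carrier (BijGroup (lists (set cs)))"
    and "\<And>w. w \<in> lists (set cs) \<Longrightarrow> length (f w) = length w"
    and "\<And>w. w \<in> lists (set cs) \<Longrightarrow> \<exists>k. \<forall>x\<in>set cs. f (w @ [x]) = f w @ [(cycle_of_list cs ^^ k) x]"
  shows "f \<in> cyclic_tree_perms cs"
  using assms unfolding cyclic_tree_perms_def by blast

lemma cyclic_tree_permsD:
  assumes "f \<in> cyclic_tree_perms cs"
  shows "f \<in> carrier (BijGroup (lists (set cs)))"
    and "w \<in> lists (set cs) \<Longrightarrow> length (f w) = length w"
    and "w \<in> lists (set cs) \<Longrightarrow> \<exists>k. \<forall>x\<in>set cs. f (w @ [x]) = f w @ [(cycle_of_list cs ^^ k) x]"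
  using assms unfolding cyclic_tree_perms_def by blast+

lemma snoc_in_lists: "w \<in> lists X \<Longrightarrow> x \<in> X \<Longrightarrow> w @ [x] \<in> lists X"
  by simp

text \<open>Exponents add along a product; the inverse of \<open>f\<close> acts at \<open>w\<close>
  with the negative of the exponent of \<open>f\<close> at the preimage of \<open>w\<close>.\<close>

lemma subgroup_cyclic_tree_perms:
  assumes "cycle cs"
  shows "subgroup (cyclic_tree_perms cs) (BijGroup (lists (set cs)))"
proof -
  let ?W = "lists (set cs)" and ?c = "cycle_of_list cs"
  interpret group "BijGroup ?W" by (rule group_BijGroup)
  show ?thesis
  proof (rule subgroupI)
    show "cyclic_tree_perms cs \<subseteq> carrier (BijGroup ?W)" using cyclic_tree_permsD(1) by blast
    have "\<one>\<^bsub>BijGroup ?W\<^esub> \<in> cyclic_tree_perms cs"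
    proof (rule cyclic_tree_permsI)
      fix w assume "w \<in> ?W"
      then show "\<exists>k. \<forall>x\<in>set cs. \<one>\<^bsub>BijGroup ?W\<^esub> (w @ [x]) = \<one>\<^bsub>BijGroup ?W\<^esub> w @ [(?c ^^ k) x]"
        by (intro exI[of _ 0]) (simp add: BijGroup_one_apply)
    qed (simp_all add: BijGroup_one_apply)
    then show "cyclic_tree_perms cs \<noteq> {}" by blast
  next
    fix f g assume f: "f \<in> cyclic_tree_perms cs" and g: "g \<in> cyclic_tree_perms cs"
    note c = cyclic_tree_permsD(1)[OF f] cyclic_tree_permsD(1)[OF g]
    show "f \<otimes>\<^bsub>BijGroup ?W\<^esub> g \<in> cyclic_tree_perms cs"
    proof (rule cyclic_tree_permsI)
      fix w assume w: "w \<in> ?W"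
      have gw: "g w \<in> ?W" using BijGroup_apply_in[OF c(2) w] .
      show "length ((f \<otimes>\<^bsub>BijGroup ?W\<^esub> g) w) = length w"
        using cyclic_tree_permsD(2)[OF f gw] cyclic_tree_permsD(2)[OF g w]
        by (simp only: BijGroup_mult_apply[OF c w])
      obtain k where k: "\<And>x. x \<in> set cs \<Longrightarrow> g (w @ [x]) = g w @ [(?c ^^ k) x]"
        using cyclic_tree_permsD(3)[OF g w] by blast
      obtain l where l: "\<And>x. x \<in> set cs \<Longrightarrow> f (g w @ [x]) = f (g w) @ [(?c ^^ l) x]"
        using cyclic_tree_permsD(3)[OF f gw] by blast
      have "(f \<otimes>\<^bsub>BijGroup ?W\<^esub> g) (w @ [x]) = (f \<otimes>\<^bsub>BijGroup ?W\<^esub> g) w @ [(?c ^^ (l + k)) x]"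
        if "x \<in> set cs" for x
        using BijGroup_mult_apply[OF c w] BijGroup_mult_apply[OF c snoc_in_lists[OF w that]]
          k[OF that] l[OF cycle_of_list_funpow_in[OF that]]
        by (simp only: funpow_add comp_def)
      then show "\<exists>k. \<forall>x\<in>set cs. (f \<otimes>\<^bsub>BijGroup ?W\<^esub> g) (w @ [x]) = (f \<otimes>\<^bsub>BijGroup ?W\<^esub> g) w @ [(?c ^^ k) x]"
        by blast
    qed (use c in simp)
  next
    fix f assume f: "f \<in> cyclic_tree_perms cs"
    note c = cyclic_tree_permsD(1)[OF f]
    let ?g = "inv\<^bsub>BijGroup ?W\<^esub> f"
    have gc: "?g \<in> carrier (BijGroup ?W)" using c by simp
    have fg: "f (?g w) = w" and gf: "?g (f w) = w" if "w \<in> ?W" for w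
      using BijGroup_mult_apply[OF c gc that] BijGroup_mult_apply[OF gc c that] c that
      by (simp_all only: r_inv l_inv BijGroup_one_apply)
    show "?g \<in> cyclic_tree_perms cs"
    proof (rule cyclic_tree_permsI)
      fix w assume w: "w \<in> ?W"
      have u: "?g w \<in> ?W" using BijGroup_apply_in[OF gc w] .
      show "length (?g w) = length w"
        using cyclic_tree_permsD(2)[OF f u] by (simp only: fg[OF w])
      obtain k where k: "\<And>x. x \<in> set cs \<Longrightarrow> f (?g w @ [x]) = w @ [(?c ^^ k) x]"
        using cyclic_tree_permsD(3)[OF f u] fg[OF w] by metis
      \<comment> \<open>A natural number congruent to \<open>- k\<close> modulo
        \<open>length cs\<close>.\<close>
      let ?l = "(length cs - 1) * k"
      have "?g (w @ [x]) = ?g w @ [(?c ^^ ?l) x]" if x: "x \<in> set cs" for x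
      proof -
        have "length cs > 0" using x by (cases cs) auto
        then have "k + ?l = length cs * k" by (cases "length cs") auto
        then have "(?c ^^ k) ((?c ^^ ?l) x) = x"
          using cycle_of_list_funpow_mult_length[OF assms x, of k] by (simp only: funpow_add[symmetric] comp_apply[symmetric, of "?c ^^ k"])
        then have "f (?g w @ [(?c ^^ ?l) x]) = w @ [x]"
          using k[OF cycle_of_list_funpow_in[OF x]] by simp
        then show ?thesis
          using gf[OF snoc_in_lists[OF u cycle_of_list_funpow_in[OF x]], of ?l] by simp
      qed
      then show "\<exists>k. \<forall>x\<in>set cs. ?g (w @ [x]) = ?g w @ [(?c ^^ k) x]" by blast
    qed (rule gc)
  qed
qed

text \<open>By induction on the length: the power for \<open>w\<close> fixes \<open>w\<close>, hence
  moves all its children by one power of the cycle, and raising it to the power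
  \<open>length cs\<close> fixes each child.\<close>

lemma cyclic_tree_perms_pow_level:
  assumes "cycle cs" "f \<in> cyclic_tree_perms cs" "w \<in> lists (set cs)"
  shows "(f [^]\<^bsub>BijGroup (lists (set cs))\<^esub> (length cs ^ length w :: nat)) w = w"
  using assms(3)
proof (induction w rule: rev_induct)
  case Nil
  have "length (f []) = length []" using cyclic_tree_permsD(2)[OF assms(2)] by simp
  then show ?case
    using BijGroup_pow_apply[OF cyclic_tree_permsD(1)[OF assms(2)], of "[]" 1] by simp
next
  case (snoc x w)
  let ?W = "lists (set cs)" and ?c = "cycle_of_list cs" and ?p = "length cs"
  interpret group "BijGroup ?W" by (rule group_BijGroup)
  have x: "x \<in> set cs" "w \<in> ?W" using snoc.prems by auto
  define h where "h = f [^]\<^bsub>BijGroup ?W\<^esub> (?p ^ length w)"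
  have hU: "h \<in> cyclic_tree_perms cs"
    using subgroup_int_pow_closed[OF subgroup_cyclic_tree_perms[OF assms(1)] assms(2), of "int (?p ^ length w)"]
    by (simp only: h_def int_pow_int)
  note hc = cyclic_tree_permsD(1)[OF hU]
  have "h w = w" using snoc.IH x by (simp add: h_def)
  then obtain k where k: "\<And>y. y \<in> set cs \<Longrightarrow> h (w @ [y]) = w @ [(?c ^^ k) y]"
    using cyclic_tree_permsD(3)[OF hU x(2)] by metis
  have "(h ^^ n) (w @ [x]) = w @ [(?c ^^ (n * k)) x]" for n
    using x(1) by (induction n) (simp_all add: k cycle_of_list_funpow_in funpow_add)
  then have "(h [^]\<^bsub>BijGroup ?W\<^esub> ?p) (w @ [x]) = w @ [x]"
    using BijGroup_pow_apply[OF hc snoc_in_lists[OF x(2,1)]]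
      cycle_of_list_funpow_mult_length[OF assms(1) x(1)] by simp
  then show ?case
    using cyclic_tree_permsD(1)[OF assms(2)] by (simp add: h_def nat_pow_pow mult.commute)
qed

text \<open>The children of \<open>w\<close> are permuted by the output function of the state
  reached after reading \<open>w\<close>.\<close>

lemma autom_perm_in_cyclic_tree_perms:
  assumes A: "finite_automaton A" "permutational A" and cs: "set cs = alphabet A"
    and pow: "\<And>q. q \<in> states A \<Longrightarrow> \<exists>n. \<forall>x\<in>alphabet A. out_fn A q x = (cycle_of_list cs ^^ n) x"
    and q: "q \<in> states A"
  shows "autom_perm A q \<in> cyclic_tree_perms cs"
proof (rule cyclic_tree_permsI)
  show "autom_perm A q \<in> carrier (BijGroup (lists (set cs)))"
    unfolding cs by (rule autom_perm_in_BijGroup[OF A q])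
  fix w assume w: "w \<in> lists (set cs)"
  then show "length (autom_perm A q w) = length w" by (simp add: autom_perm_def cs)
  have "\<exists>k. \<forall>x\<in>set cs. out_word A q (w @ [x]) = out_word A q w @ [(cycle_of_list cs ^^ k) x]"
    using w q
  proof (induction w arbitrary: q)
    case Nil
    then show ?case using pow cs by simp
  next
    case (Cons y w)
    then have "trans_fn A q y \<in> states A" using A(1) by (auto simp: finite_automaton_def cs)
    then show ?case using Cons by simp
  qed
  then show "\<exists>k. \<forall>x\<in>set cs. autom_perm A q (w @ [x]) = autom_perm A q w @ [(cycle_of_list cs ^^ k) x]"
    using w by (simp add: autom_perm_def cs)
qed

text \<open>Length is preserved, also by preimages, so each level of the tree is permuted in
  itself.\<close>

lemma restrict_level_hom:
  assumes "cycle cs"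
  defines "Y \<equiv> \<lambda>n. {w \<in> lists (set cs). length w = n}"
  shows "(\<lambda>f. restrict f (Y n)) \<in> hom (BijGroup (lists (set cs))\<lparr>carrier := cyclic_tree_perms cs\<rparr>) (BijGroup (Y n))"
proof -
  let ?W = "lists (set cs)"
  have YW: "w \<in> ?W" if "w \<in> Y n" for w using that by (simp add: Y_def)
  have bij: "restrict f (Y n) \<in> carrier (BijGroup (Y n))" if f: "f \<in> cyclic_tree_perms cs" for f
  proof -
    note c = cyclic_tree_permsD(1)[OF f]
    have b: "bij_betw f ?W ?W" using c by (simp add: BijGroup_def Bij_def)
    have "f ` Y n \<subseteq> Y n"
    proof (rule image_subsetI)
      fix w assume "w \<in> Y n"
      then have "w \<in> ?W" "length w = n" by (auto simp: Y_def)
      then show "f w \<in> Y n"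
        unfolding Y_def using cyclic_tree_permsD(2)[OF f] BijGroup_apply_in[OF c] by (intro CollectI conjI) metis+
    qed
    moreover have "Y n \<subseteq> f ` Y n"
    proof
      fix w assume w: "w \<in> Y n"
      have "w \<in> f ` ?W" unfolding bij_betw_imp_surj_on[OF b] by (rule YW[OF w])
      then obtain u where u: "u \<in> ?W" "f u = w" by (auto elim!: imageE simp del: in_lists_conv_set)
      then have "u \<in> Y n" using w cyclic_tree_permsD(2)[OF f u(1)] unfolding Y_def by simp
      then show "w \<in> f ` Y n" using u by blast
    qed
    moreover have "inj_on f (Y n)" using b YW inj_on_subset[of f ?W "Y n"] unfolding bij_betw_def by blast
    ultimately have "bij_betw f (Y n) (Y n)" by (simp add: bij_betw_def subset_antisym)
    then show ?thesis by (simp add: BijGroup_def Bij_def)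
  qed
  show ?thesis
  proof (rule homI)
    fix f assume "f \<in> carrier (BijGroup ?W\<lparr>carrier := cyclic_tree_perms cs\<rparr>)"
    then have f: "f \<in> cyclic_tree_perms cs" by simp
    then show "restrict f (Y n) \<in> carrier (BijGroup (Y n))" by (rule bij)
    fix g assume "g \<in> carrier (BijGroup ?W\<lparr>carrier := cyclic_tree_perms cs\<rparr>)"
    then have g: "g \<in> cyclic_tree_perms cs" by simp
    interpret W: group "BijGroup ?W" by (rule group_BijGroup)
    have fg: "f \<otimes>\<^bsub>BijGroup ?W\<^esub> g \<in> cyclic_tree_perms cs"
      using subgroup.m_closed[OF subgroup_cyclic_tree_perms[OF assms(1)] f g] .
    interpret Y: group "BijGroup (Y n)" by (rule group_BijGroup)
    have "restrict (f \<otimes>\<^bsub>BijGroup ?W\<^esub> g) (Y n) = restrict f (Y n) \<otimes>\<^bsub>BijGroup (Y n)\<^esub> restrict g (Y n)"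
    proof (rule BijGroup_eqI[OF bij[OF fg] Y.m_closed[OF bij[OF f] bij[OF g]]])
      fix w assume w: "w \<in> Y n"
      have "restrict g (Y n) w \<in> Y n" by (rule BijGroup_apply_in[OF bij[OF g] w])
      then show "restrict (f \<otimes>\<^bsub>BijGroup ?W\<^esub> g) (Y n) w =
          (restrict f (Y n) \<otimes>\<^bsub>BijGroup (Y n)\<^esub> restrict g (Y n)) w"
        using w by (simp add: BijGroup_mult_apply[OF bij[OF f] bij[OF g] w]
            BijGroup_mult_apply[OF cyclic_tree_permsD(1)[OF f] cyclic_tree_permsD(1)[OF g] YW[OF w]])
    qed
    then show "restrict (f \<otimes>\<^bsub>BijGroup ?W\<lparr>carrier := cyclic_tree_perms cs\<rparr>\<^esub> g) (Y n) =
        restrict f (Y n) \<otimes>\<^bsub>BijGroup (Y n)\<^esub> restrict g (Y n)" by simp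
  qed
qed

lemma residually_p_finite_if_generated_by_p_automaton:
  assumes "prime p" "group G" "generated_by_finite_p_automaton p G"
  shows "residually_p_finite p G"
  unfolding residually_p_finite_def
proof (intro ballI impI)
  fix g assume g: "g \<in> carrier G" "g \<noteq> \<one>\<^bsub>G\<^esub>"
  obtain A :: "(nat, nat) automaton" and S where A: "p_automaton p A" "S \<subseteq> states A"
    and iso: "G \<cong> subgroup_generated (BijGroup (lists (alphabet A))) (autom_perm A ` S)"
    using assms(3) by (auto simp: generated_by_finite_p_automaton_def)
  obtain cs where cs: "cycle cs" "set cs = alphabet A"
    and pow: "\<And>q. q \<in> states A \<Longrightarrow> \<exists>n. \<forall>x\<in>alphabet A. out_fn A q x = (cycle_of_list cs ^^ n) x"
    using A(1) by (auto simp: p_automaton_def)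
  have fp: "finite_automaton A" "permutational A" "card (alphabet A) = p"
    using A(1) by (auto simp: p_automaton_def)
  have len: "length cs = p" using fp(3) cs distinct_card by metis
  let ?W = "lists (set cs)" and ?U = "cyclic_tree_perms cs"
  interpret G: group G by fact
  interpret W: group "BijGroup ?W" by (rule group_BijGroup)
  let ?\<Gamma> = "subgroup_generated (BijGroup ?W) (autom_perm A ` S)"
  obtain \<phi> where \<phi>: "\<phi> \<in> iso G ?\<Gamma>" using iso cs(2) by (auto simp: is_iso_def)
  have U: "subgroup ?U (BijGroup ?W)" by (rule subgroup_cyclic_tree_perms[OF cs(1)])
  have "carrier ?\<Gamma> \<subseteq> ?U"
    using A(2) autom_perm_in_cyclic_tree_perms[OF fp(1,2) cs(2) pow]
    by (intro W.subgroup_generated_minimal[OF U]) auto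
  then have \<phi>U: "\<phi> \<in> hom G (BijGroup ?W\<lparr>carrier := ?U\<rparr>)"
    using \<phi> by (auto simp: iso_def hom_def)
  have \<phi>g: "\<phi> g \<in> ?U" using \<phi>U g(1) by (auto simp: hom_def)
  have "\<phi> g \<noteq> \<one>\<^bsub>BijGroup ?W\<^esub>"
  proof -
    interpret \<Gamma>: group ?\<Gamma> by simp
    interpret \<phi>: group_hom G ?\<Gamma> \<phi> using \<phi> by unfold_locales (simp add: iso_def)
    show ?thesis using \<phi> g \<phi>.iso_iff by auto
  qed
  \<comment> \<open>A word moved by \<open>\<phi> g\<close> determines the level on which
    \<open>g\<close> acts non-trivially.\<close>
  then obtain w where w: "w \<in> ?W" "\<phi> g w \<noteq> w"
    using BijGroup_eqI[OF cyclic_tree_permsD(1)[OF \<phi>g] W.one_closed] BijGroup_one_apply by metis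
  define Y where "Y = {u \<in> ?W. length u = length w}"
  let ?\<rho> = "\<lambda>f. restrict f Y"
  interpret Y: group "BijGroup Y" by (rule group_BijGroup)
  interpret U: group "BijGroup ?W\<lparr>carrier := ?U\<rparr>" by (rule W.subgroup_imp_group[OF U])
  have \<rho>: "?\<rho> \<in> hom (BijGroup ?W\<lparr>carrier := ?U\<rparr>) (BijGroup Y)"
    using restrict_level_hom[OF cs(1), of "length w"] by (simp add: Y_def)
  interpret \<rho>: group_hom "BijGroup ?W\<lparr>carrier := ?U\<rparr>" "BijGroup Y" ?\<rho>
    using \<rho> by unfold_locales
  \<comment> \<open>The image of all cyclic tree permutations, not only of the automaton group; its
    elements have order dividing \<open>p ^ length w\<close>.\<close>
  let ?P = "BijGroup Y\<lparr>carrier := ?\<rho> ` ?U\<rparr>"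
  have sub: "subgroup (?\<rho> ` ?U) (BijGroup Y)"
    using \<rho>.subgroup_img_is_subgroup[OF U.subgroup_self] by simp
  then have P: "group ?P" by (rule Y.subgroup_imp_group)
  have "finite Y"
    using finite_lists_length_eq[of "set cs" "length w"] by (simp add: Y_def lists_eq_set)
  have "carrier (BijGroup Y) \<subseteq> Y \<rightarrow>\<^sub>E Y"
    by (auto simp: BijGroup_def Bij_def PiE_def bij_betwE)
  then have "finite (carrier (BijGroup Y))"
    using finite_PiE[OF \<open>finite Y\<close>, of "\<lambda>_. Y"] \<open>finite Y\<close> finite_subset by blast
  then have finP: "finite (carrier ?P)"
    using subgroup.subset[OF sub] finite_subset by auto
  have "x [^]\<^bsub>?P\<^esub> (p ^ length w) = \<one>\<^bsub>?P\<^esub>" if "x \<in> carrier ?P" for x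
  proof -
    from that obtain f where f: "f \<in> ?U" "x = ?\<rho> f" by auto
    let ?q = "p ^ length w"
    have x: "x \<in> carrier (BijGroup Y)" using that subgroup.subset[OF sub] by auto
    have "x [^]\<^bsub>BijGroup Y\<^esub> ?q = \<one>\<^bsub>BijGroup Y\<^esub>"
    proof (rule BijGroup_eqI[of _ Y])
      fix u assume u: "u \<in> Y"
      have uW: "u \<in> ?W" "length u = length w" using u by (simp_all add: Y_def)
      have "x [^]\<^bsub>BijGroup Y\<^esub> ?q = ?\<rho> (f [^]\<^bsub>BijGroup ?W\<lparr>carrier := ?U\<rparr>\<^esub> ?q)"
        using \<rho>.hom_nat_pow[of f ?q] f by simp
      also have "f [^]\<^bsub>BijGroup ?W\<lparr>carrier := ?U\<rparr>\<^esub> ?q = f [^]\<^bsub>BijGroup ?W\<^esub> ?q"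
        by (rule W.nat_pow_consistent[symmetric])
      finally show "(x [^]\<^bsub>BijGroup Y\<^esub> ?q) u = \<one>\<^bsub>BijGroup Y\<^esub> u"
        using cyclic_tree_perms_pow_level[OF cs(1) f(1) uW(1)] u
        by (simp add: len uW(2) BijGroup_one_apply)
    qed (use x in simp_all)
    then show ?thesis by (simp add: Y.nat_pow_consistent[symmetric])
  qed
  then obtain n where n: "order ?P = p ^ n"
    using order_prime_power_if_exponent[OF P finP assms(1)] by blast
  obtain H :: "nat monoid" and e where H: "group H" "finite (carrier H)" "order H = order ?P" "e \<in> iso ?P H"
    using finite_group_iso_nat[OF P finP] by blast
  let ?h = "\<lambda>x. e (?\<rho> (\<phi> x))"
  have \<rho>\<phi>: "(\<lambda>x. ?\<rho> (\<phi> x)) \<in> hom G ?P"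
    using hom_compose[OF \<phi>U \<rho>] \<phi>U by (auto simp: hom_def)
  then have h: "?h \<in> hom G H"
    using hom_compose[of _ G ?P e H] H(4) by (auto simp: iso_def comp_def)
  have "?\<rho> (\<phi> g) \<noteq> \<one>\<^bsub>?P\<^esub>"
  proof
    assume "?\<rho> (\<phi> g) = \<one>\<^bsub>?P\<^esub>"
    then have "?\<rho> (\<phi> g) w = \<one>\<^bsub>BijGroup Y\<^esub> w" by simp
    then show False using w by (simp add: Y_def BijGroup_one_apply)
  qed
  moreover have "?\<rho> (\<phi> g) \<in> carrier ?P" using \<phi>g by simp
  ultimately have "?h g \<noteq> \<one>\<^bsub>H\<^esub>"
  proof -
    assume *: "?\<rho> (\<phi> g) \<noteq> \<one>\<^bsub>?P\<^esub>" "?\<rho> (\<phi> g) \<in> carrier ?P"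
    interpret e: group_hom ?P H e
      using P H by (intro group_hom.intro group_hom_axioms.intro) (auto simp: iso_def)
    show ?thesis using * H(4) e.iso_iff by blast
  qed
  then show "\<exists>(H :: nat monoid) n h. group H \<and> finite (carrier H) \<and> order H = p ^ n \<and>
      h \<in> hom G H \<and> h g \<noteq> \<one>\<^bsub>H\<^esub>"
    using H n h by metis
qed

section \<open>Presented groups and normal forms\<close>

context group
begin

text \<open>Closure of centralizers extends commutation from elements to integer powers and
  products.\<close>

lemma subgroup_centralizer:
  assumes "y \<in> carrier G"
  shows "subgroup {x \<in> carrier G. x \<otimes> y = y \<otimes> x} G"
proof (rule subgroupI)
  fix x assume x: "x \<in> {x \<in> carrier G. x \<otimes> y = y \<otimes> x}"
  then have "inv x \<otimes> (x \<otimes> y) \<otimes> inv x = inv x \<otimes> (y \<otimes> x) \<otimes> inv x" by simp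
  then show "inv x \<in> {x \<in> carrier G. x \<otimes> y = y \<otimes> x}"
    using x assms by (simp add: m_assoc inv_solve_left inv_solve_right)
next
  fix x z assume "x \<in> {x \<in> carrier G. x \<otimes> y = y \<otimes> x}" "z \<in> {x \<in> carrier G. x \<otimes> y = y \<otimes> x}"
  then show "x \<otimes> z \<in> {x \<in> carrier G. x \<otimes> y = y \<otimes> x}"
    using assms by simp (metis m_assoc)
qed (use assms in auto)

lemma int_pow_commute:
  assumes "x \<in> carrier G" "y \<in> carrier G" "x \<otimes> y = y \<otimes> x"
  shows "x [^] (k :: int) \<otimes> y = y \<otimes> x [^] k"
  using subgroup_int_pow_closed[OF subgroup_centralizer[OF assms(2)], of x k] assms by simp

lemma conj_hom: "t \<in> carrier G \<Longrightarrow> (\<lambda>x. inv t \<otimes> x \<otimes> t) \<in> hom G G"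
  by (auto simp: hom_def m_assoc) (metis inv_closed l_inv l_one m_assoc m_closed r_inv)

end

text \<open>Row vectors are used because the relation for \<open>a i\<close> carries row
  \<open>i\<close> of \<open>M\<close> as exponents. Smaller values of \<open>r\<close> give the
  contribution of the first rows only, which \<open>A_conj\<close> uses for its induction.\<close>

definition lmul :: "nat \<Rightarrow> int mat \<Rightarrow> ivec \<Rightarrow> ivec" where
  "lmul r M v = (\<lambda>j. \<Sum>i<r. v i * M $$ (i, j))"

primrec pow_prod :: "('g, 'b) monoid_scheme \<Rightarrow> (nat \<Rightarrow> 'g) \<Rightarrow> nat \<Rightarrow> ivec \<Rightarrow> 'g" where
  "pow_prod G a 0 v = \<one>\<^bsub>G\<^esub>"
| "pow_prod G a (Suc n) v = pow_prod G a n v \<otimes>\<^bsub>G\<^esub> a n [^]\<^bsub>G\<^esub> v n"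

lemma pow_prod_cong:
  "(\<And>i. i < n \<Longrightarrow> a i = b i) \<Longrightarrow> (\<And>i. i < n \<Longrightarrow> v i = w i) \<Longrightarrow> pow_prod G a n v = pow_prod G b n w"
  by (induction n) auto

text \<open>Abstracts from the presentation: it is interpreted both in \<open>GM M\<close> and in
  the group of permutations of words.\<close>

locale GM_relations = group G for G (structure) +
  fixes a :: "nat \<Rightarrow> 'a" and t :: 'a and r :: nat and M :: "int mat"
  assumes a_closed: "\<And>i. i < r \<Longrightarrow> a i \<in> carrier G" and t_closed: "t \<in> carrier G"
    and a_commute: "\<And>i j. i < r \<Longrightarrow> j < r \<Longrightarrow> a i \<otimes> a j = a j \<otimes> a i"
    and a_conj: "\<And>i. i < r \<Longrightarrow> inv t \<otimes> a i \<otimes> t = pow_prod G a r (\<lambda>j. M $$ (i, j))"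
begin

abbreviation A :: "nat \<Rightarrow> ivec \<Rightarrow> 'a" where
  "A \<equiv> pow_prod G a"

lemma A_closed: "n \<le> r \<Longrightarrow> A n v \<in> carrier G"
  by (induction n) (auto simp: a_closed)

lemma A_commute_a:
  assumes "n \<le> r" "i < r"
  shows "A n v \<otimes> a i [^] (k :: int) = a i [^] k \<otimes> A n v"
proof -
  let ?y = "a i [^] k"
  have y: "?y \<in> carrier G" using assms a_closed by simp
  have Z: "subgroup {x \<in> carrier G. x \<otimes> ?y = ?y \<otimes> x} G" by (rule subgroup_centralizer[OF y])
  have "A n v \<in> {x \<in> carrier G. x \<otimes> ?y = ?y \<otimes> x}"
    using assms(1)
  proof (induction n)
    case 0
    then show ?case using subgroup.one_closed[OF Z] by simp
  next
    case (Suc n)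
    have "a n \<otimes> ?y = ?y \<otimes> a n"
      using int_pow_commute[of "a i" "a n" k] Suc.prems assms(2) a_closed a_commute by simp
    then have "a n \<in> {x \<in> carrier G. x \<otimes> ?y = ?y \<otimes> x}" using Suc.prems a_closed by simp
    then have "a n [^] v n \<in> {x \<in> carrier G. x \<otimes> ?y = ?y \<otimes> x}"
      by (rule subgroup_int_pow_closed[OF Z])
    moreover have "A n v \<in> {x \<in> carrier G. x \<otimes> ?y = ?y \<otimes> x}" using Suc by simp
    ultimately have "A n v \<otimes> a n [^] v n \<in> {x \<in> carrier G. x \<otimes> ?y = ?y \<otimes> x}"
      by (intro subgroup.m_closed[OF Z])
    then show ?case by simp
  qed
  then show ?thesis by simp
qed

lemma A_add: "n \<le> r \<Longrightarrow> A n (v + w) = A n v \<otimes> A n w"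
proof (induction n)
  case (Suc n)
  have c: "a n \<in> carrier G" "A n v \<in> carrier G" "A n w \<in> carrier G"
    using Suc.prems by (auto simp: a_closed A_closed)
  have IH: "A n (v + w) = A n v \<otimes> A n w" using Suc by simp
  have "A (Suc n) (v + w) = A n v \<otimes> A n w \<otimes> (a n [^] v n \<otimes> a n [^] w n)"
    using c by (simp add: IH pointwise int_pow_mult)
  also have "\<dots> = A n v \<otimes> (A n w \<otimes> a n [^] v n) \<otimes> a n [^] w n"
    using c by (simp add: m_assoc)
  also have "A n w \<otimes> a n [^] v n = a n [^] v n \<otimes> A n w"
    using A_commute_a[of n n] Suc.prems by simp
  also have "A n v \<otimes> (a n [^] v n \<otimes> A n w) \<otimes> a n [^] w n = A (Suc n) v \<otimes> A (Suc n) w"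
    using c by (simp add: m_assoc)
  finally show ?case .
qed simp

lemma A_0: "n \<le> r \<Longrightarrow> A n 0 = \<one>"
  by (induction n) (auto simp: pointwise a_closed)

lemma A_uminus: "n \<le> r \<Longrightarrow> A n (- v) = inv (A n v)"
  using A_add[of n "- v" v] A_0[of n] by (intro inv_equality[symmetric]) (simp_all add: A_closed)

lemma A_of_int: "n \<le> r \<Longrightarrow> A n (of_int k * v) = A n v [^] k"
proof (induction k rule: int_induct[where k = 0])
  case base
  then show ?case by (simp add: A_0)
next
  case (step1 k)
  then have "A n (of_int (k + 1) * v) = A n (of_int k * v) \<otimes> A n v"
    by (simp add: distrib_right A_add)
  then show ?case using step1 by (simp add: int_pow_mult A_closed)
next
  case (step2 k)
  have "of_int (k - 1) * v = of_int k * v + - v" by (simp add: left_diff_distrib)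
  then have "A n (of_int (k - 1) * v) = A n (of_int k * v) \<otimes> inv (A n v)"
    using step2.prems by (simp only: A_add A_uminus)
  then show ?case using step2 by (simp add: int_pow_diff A_closed)
qed

lemma A_unit: "i < r \<Longrightarrow> n \<le> r \<Longrightarrow> A n (\<lambda>j. if j = i then 1 else 0) = (if i < n then a i else \<one>)"
  by (induction n) (auto simp: a_closed less_Suc_eq)

text \<open>Conjugation by \<open>t\<close> is a homomorphism, so the relations for the generators
  extend to their products, by induction on the number of generators involved.\<close>

lemma A_conj: "inv t \<otimes> A r v \<otimes> t = A r (lmul r M v)"
proof -
  let ?c = "\<lambda>x. inv t \<otimes> x \<otimes> t"
  interpret c: group_hom G G ?c
    using conj_hom[OF t_closed] by unfold_locales
  have "?c (A n v) = A r (lmul n M v)" if "n \<le> r" for n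
    using that
  proof (induction n)
    case 0
    have "lmul 0 M v = 0" by (auto simp: lmul_def pointwise)
    then show ?case using t_closed by (simp add: A_0)
  next
    case (Suc n)
    have "?c (A (Suc n) v) = ?c (A n v) \<otimes> ?c (a n) [^] v n"
      using Suc.prems c.hom_mult[of "A n v" "a n [^] v n"] c.hom_int_pow[of "a n" "v n"]
      by (simp add: a_closed A_closed)
    also have "\<dots> = A r (lmul n M v) \<otimes> A r (of_int (v n) * (\<lambda>j. M $$ (n, j)))"
      using Suc by (simp add: a_conj A_of_int)
    also have "\<dots> = A r (lmul n M v + of_int (v n) * (\<lambda>j. M $$ (n, j)))"
      by (simp add: A_add)
    also have "lmul n M v + of_int (v n) * (\<lambda>j. M $$ (n, j)) = lmul (Suc n) M v"
      by (auto simp: lmul_def pointwise)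
    finally show ?case .
  qed
  then show ?thesis by simp
qed

text \<open>Positive powers of \<open>t\<close> move to the left and, by the next lemma, negative
  ones to the right, each factor applying \<open>M\<close> once to the exponents. The opposite moves
  would call for an integral inverse of \<open>M\<close>.\<close>

lemma A_t_pow: "A r v \<otimes> t [^] (d :: nat) = t [^] d \<otimes> A r ((lmul r M ^^ d) v)"
proof (induction d)
  case 0
  then show ?case by (simp add: A_closed)
next
  case (Suc d)
  let ?w = "(lmul r M ^^ d) v"
  have "A r ?w \<otimes> t = t \<otimes> (inv t \<otimes> A r ?w \<otimes> t)"
    using t_closed A_closed[of r ?w] by (simp add: m_assoc[symmetric])
  then have *: "A r ?w \<otimes> t = t \<otimes> A r (lmul r M ?w)" by (simp add: A_conj)
  have "A r v \<otimes> t [^] Suc d = A r v \<otimes> t [^] d \<otimes> t"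
    using t_closed A_closed[of r v] by (simp add: m_assoc)
  also have "\<dots> = t [^] d \<otimes> (A r ?w \<otimes> t)"
    using t_closed A_closed[of r ?w] by (simp add: Suc m_assoc)
  also have "\<dots> = t [^] Suc d \<otimes> A r ((lmul r M ^^ Suc d) v)"
    using t_closed A_closed[of r "lmul r M ?w"] by (simp add: * m_assoc)
  finally show ?case .
qed

lemma inv_t_pow_A: "inv (t [^] (d :: nat)) \<otimes> A r v = A r ((lmul r M ^^ d) v) \<otimes> inv (t [^] d)"
  using A_t_pow[of v d] t_closed A_closed[of r]
  by (metis inv_closed inv_solve_left' inv_solve_right m_assoc m_closed nat_pow_closed order_refl)

definition normal_forms :: "'a set" where
  "normal_forms = {t [^] n \<otimes> A r v \<otimes> inv (t [^] m) |(n :: nat) v (m :: nat). True}"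

text \<open>In a product the middle factor \<open>t^(-m) t^n'\<close> is a power of \<open>t\<close>
  of one sign; a positive one is moved left, a negative one right, and then the exponent vectors add
  up.\<close>

lemma subgroup_normal_forms: "subgroup normal_forms G"
proof (rule subgroupI)
  show "normal_forms \<subseteq> carrier G" by (auto simp: normal_forms_def t_closed A_closed)
  show "normal_forms \<noteq> {}" by (auto simp: normal_forms_def)
  fix x assume "x \<in> normal_forms"
  then obtain n m :: nat and v where x: "x = t [^] n \<otimes> A r v \<otimes> inv (t [^] m)"
    by (auto simp: normal_forms_def)
  have "inv x = t [^] m \<otimes> A r (- v) \<otimes> inv (t [^] n)"
    by (simp add: x inv_mult_group t_closed A_closed A_uminus m_assoc)
  then show "inv x \<in> normal_forms" unfolding normal_forms_def by blast
  fix y assume "y \<in> normal_forms"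
  then obtain n' m' :: nat and w where y: "y = t [^] n' \<otimes> A r w \<otimes> inv (t [^] m')"
    by (auto simp: normal_forms_def)
  have c: "t [^] k \<in> carrier G" "A r u \<in> carrier G" for k :: nat and u
    by (simp_all add: t_closed A_closed)
  have cancel: "inv (t [^] k) \<otimes> (t [^] k \<otimes> z) = z" if "z \<in> carrier G" for k :: nat and z
    using that c by (simp flip: m_assoc)
  show "x \<otimes> y \<in> normal_forms"
  proof (cases "m \<le> n'")
    case True
    then obtain d where d: "n' = m + d" using le_Suc_ex by blast
    have "x \<otimes> y = t [^] n \<otimes> (A r v \<otimes> (inv (t [^] m) \<otimes> t [^] m) \<otimes> t [^] d) \<otimes> A r w \<otimes> inv (t [^] m')"
      using c t_closed by (simp add: x y d m_assoc cancel flip: nat_pow_mult)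
    also have "\<dots> = t [^] n \<otimes> (A r v \<otimes> t [^] d) \<otimes> A r w \<otimes> inv (t [^] m')"
      using c by simp
    also have "\<dots> = (t [^] n \<otimes> t [^] d) \<otimes> (A r ((lmul r M ^^ d) v) \<otimes> A r w) \<otimes> inv (t [^] m')"
      using c by (simp add: A_t_pow m_assoc)
    also have "\<dots> = t [^] (n + d) \<otimes> A r ((lmul r M ^^ d) v + w) \<otimes> inv (t [^] m')"
      by (simp add: nat_pow_mult t_closed A_add)
    finally show ?thesis unfolding normal_forms_def by blast
  next
    case False
    then obtain d where d: "m = n' + d" by (metis le_Suc_ex nat_le_linear)
    have "inv (t [^] m) = inv (t [^] d) \<otimes> inv (t [^] n')"
      using t_closed by (simp add: d flip: nat_pow_mult) (simp add: inv_mult_group)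
    then have "x \<otimes> y = t [^] n \<otimes> A r v \<otimes> (inv (t [^] d) \<otimes> (inv (t [^] n') \<otimes> t [^] n') \<otimes> A r w) \<otimes> inv (t [^] m')"
      using c by (simp add: x y m_assoc cancel)
    also have "\<dots> = t [^] n \<otimes> A r v \<otimes> (inv (t [^] d) \<otimes> A r w) \<otimes> inv (t [^] m')"
      using c by simp
    also have "\<dots> = t [^] n \<otimes> (A r v \<otimes> A r ((lmul r M ^^ d) w)) \<otimes> (inv (t [^] d) \<otimes> inv (t [^] m'))"
      using c by (simp add: inv_t_pow_A m_assoc)
    also have "inv (t [^] d) \<otimes> inv (t [^] m') = inv (t [^] (m' + d))"
      using c t_closed by (simp add: inv_mult_group flip: nat_pow_mult)
    also have "A r v \<otimes> A r ((lmul r M ^^ d) w) = A r (v + (lmul r M ^^ d) w)" by (simp add: A_add)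
    finally show ?thesis unfolding normal_forms_def by blast
  qed
qed

lemma generate_subset_normal_forms: "generate G (a ` {..<r} \<union> {t}) \<subseteq> normal_forms"
proof (rule generate_subgroup_incl[OF _ subgroup_normal_forms])
  have "t = t [^] (1::nat) \<otimes> A r 0 \<otimes> inv (t [^] (0::nat))" by (simp add: A_0 t_closed)
  then have "t \<in> normal_forms" unfolding normal_forms_def by blast
  moreover have "a i \<in> normal_forms" if "i < r" for i
  proof -
    have "a i = t [^] (0::nat) \<otimes> A r (\<lambda>j. if j = i then 1 else 0) \<otimes> inv (t [^] (0::nat))"
      using that by (simp add: A_unit a_closed)
    then show ?thesis unfolding normal_forms_def by blast
  qed
  ultimately show "a ` {..<r} \<union> {t} \<subseteq> normal_forms" by blast
qed

end

lemma (in group_hom) hom_pow_prod: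
  "(\<And>i. i < n \<Longrightarrow> a i \<in> carrier G) \<Longrightarrow> h (pow_prod G a n v) = pow_prod H (\<lambda>i. h (a i)) n v"
proof (induction n)
  case (Suc n)
  have "pow_prod G a n v \<in> carrier G"
    using Suc.prems by (induction n) auto
  then show ?case using Suc by (simp add: hom_int_pow)
qed simp

section \<open>Evaluation of words and homomorphisms out of a presented group\<close>

definition word_eval :: "('a, 'b) monoid_scheme \<Rightarrow> ('g \<Rightarrow> 'a) \<Rightarrow> 'g gword \<Rightarrow> 'a" where
  "word_eval G f w = foldr (\<lambda>(x, b) y. (if b then f x else inv\<^bsub>G\<^esub> f x) \<otimes>\<^bsub>G\<^esub> y) w \<one>\<^bsub>G\<^esub>"

context group
begin

lemma word_eval_Nil: "word_eval G f [] = \<one>"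
  by (simp add: word_eval_def)

lemma word_eval_Cons: "word_eval G f ((x, b) # w) = (if b then f x else inv f x) \<otimes> word_eval G f w"
  by (simp add: word_eval_def)

context
  fixes f :: "'g \<Rightarrow> 'a" and X :: "'g set"
  assumes f: "\<And>x. x \<in> X \<Longrightarrow> f x \<in> carrier G"
begin

lemma word_eval_closed: "w \<in> gwords X \<Longrightarrow> word_eval G f w \<in> carrier G"
  by (induction w) (auto simp: word_eval_Nil word_eval_Cons f)

lemma word_eval_append:
  "u \<in> gwords X \<Longrightarrow> v \<in> gwords X \<Longrightarrow> word_eval G f (u @ v) = word_eval G f u \<otimes> word_eval G f v"
  by (induction u) (auto simp: word_eval_Nil word_eval_Cons word_eval_closed f m_assoc)

lemma word_eval_pres_cong:
  assumes "\<And>s t. (s, t) \<in> R \<Longrightarrow> s \<in> gwords X \<Longrightarrow> t \<in> gwords X \<Longrightarrow> word_eval G f s = word_eval G f t"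
    and "(u, v) \<in> pres_cong X R"
  shows "word_eval G f u = word_eval G f v"
  using assms(2)
proof (induction rule: pres_cong.induct)
  case (cancel u v x b)
  have "word_eval G f ([(x, b), (x, \<not> b)] @ v) = word_eval G f v"
    using cancel by (auto simp: word_eval_Cons word_eval_closed f m_assoc[symmetric])
  then show ?case using cancel by (simp add: word_eval_append del: append.simps)
next
  case (rel u v s t)
  then show ?case using assms(1)[of s t] by (simp add: word_eval_append)
qed auto

text \<open>Von Dyck's theorem: a map of the generators that respects the relations extends to the
  presented group.\<close>

lemma presented_group_hom:
  assumes "\<And>s t. (s, t) \<in> R \<Longrightarrow> s \<in> gwords X \<Longrightarrow> t \<in> gwords X \<Longrightarrow> word_eval G f s = word_eval G f t"
  obtains h where "h \<in> hom (presented_group X R) G"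
    "\<And>w. w \<in> gwords X \<Longrightarrow> h (pres_cong X R `` {w}) = word_eval G f w"
proof
  \<comment> \<open>Any representative will do, as evaluation is constant on classes.\<close>
  define h where "h S = word_eval G f (SOME w. w \<in> S)" for S
  show h: "h (pres_cong X R `` {w}) = word_eval G f w" if "w \<in> gwords X" for w
  proof -
    have "(SOME u. u \<in> pres_cong X R `` {w}) \<in> pres_cong X R `` {w}"
      using pres_cong.refl[OF that, of R] by (intro someI) blast
    then show ?thesis
      unfolding h_def using word_eval_pres_cong[OF assms] by auto
  qed
  show "h \<in> hom (presented_group X R) G"
  proof (rule homI)
    fix x assume "x \<in> carrier (presented_group X R)"
    then obtain u where u: "u \<in> gwords X" "x = pres_cong X R `` {u}"
      by (auto simp: presented_group_def quotient_def)
    show "h x \<in> carrier G" using u by (simp add: h word_eval_closed)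
    fix y assume "y \<in> carrier (presented_group X R)"
    then obtain v where v: "v \<in> gwords X" "y = pres_cong X R `` {v}"
      by (auto simp: presented_group_def quotient_def)
    show "h (x \<otimes>\<^bsub>presented_group X R\<^esub> y) = h x \<otimes> h y"
      using u v by (simp add: presented_group_mult h word_eval_append)
  qed
qed

lemma word_eval_replicate:
  "x \<in> X \<Longrightarrow> word_eval G f (replicate n (x, b)) = (if b then f x else inv f x) [^] n"
proof (induction n)
  case (Suc n)
  have c: "(if b then f x else inv f x) \<in> carrier G" using Suc.prems f by auto
  show ?case using Suc unfolding nat_pow_Suc2[OF c] by (simp add: word_eval_Cons)
qed (simp add: word_eval_Nil)

lemma word_eval_gword_power: "x \<in> X \<Longrightarrow> word_eval G f (gword_power x k) = f x [^] k"
proof -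
  assume x: "x \<in> X"
  show ?thesis
  proof (cases "0 \<le> k")
    case True
    then have "f x [^] k = f x [^] nat k" using int_pow_int[of G "f x" "nat k"] by simp
    then show ?thesis using True x by (simp add: gword_power_def word_eval_replicate)
  next
    case False
    then have "f x [^] k = inv (f x [^] nat (- k))" using int_pow_neg_int[OF f[OF x], of "nat (- k)"] by simp
    then show ?thesis using False x nat_pow_inv[OF f[OF x]] by (simp add: gword_power_def word_eval_replicate)
  qed
qed

lemma gwords_gword_power: "x \<in> X \<Longrightarrow> gword_power x k \<in> gwords X"
  by (auto simp: gword_power_def gwords_def)

lemma word_eval_pow_prod:
  assumes "\<And>j. j < n \<Longrightarrow> g j \<in> X"
  shows "word_eval G f (concat (map (\<lambda>j. gword_power (g j) (v j)) [0..<n])) = pow_prod G (\<lambda>j. f (g j)) n v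
    \<and> concat (map (\<lambda>j. gword_power (g j) (v j)) [0..<n]) \<in> gwords X"
  using assms
proof (induction n)
  case (Suc n)
  then show ?case
    by (simp add: word_eval_append word_eval_gword_power gwords_gword_power)
qed (simp add: word_eval_Nil)

end

end

lemma presented_group_class_closed:
  "w \<in> gwords X \<Longrightarrow> pres_cong X R `` {w} \<in> carrier (presented_group X R)"
  by (auto simp: presented_group_def intro: quotientI)

text \<open>Through this the generators are seen to satisfy the relations and to generate the
  group.\<close>

lemma word_eval_presented_group:
  assumes "w \<in> gwords X"
  shows "word_eval (presented_group X R) (\<lambda>x. pres_cong X R `` {[(x, True)]}) w = pres_cong X R `` {w}"
  using assms
proof (induction w)
  case Nil
  interpret group "presented_group X R" by (rule group_presented_group)
  show ?case by (simp add: word_eval_Nil) (simp add: presented_group_def)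
next
  case (Cons y w)
  interpret group "presented_group X R" by (rule group_presented_group)
  obtain x b where y: "y = (x, b)" by (cases y)
  have x: "x \<in> X" "w \<in> gwords X" using Cons.prems by (auto simp: y)
  have "inv\<^bsub>presented_group X R\<^esub> (pres_cong X R `` {[(x, True)]}) = pres_cong X R `` {[(x, False)]}"
  proof (rule inv_equality)
    have "([(x, False), (x, \<not> False)], []) \<in> pres_cong X R"
      using pres_cong.cancel[of "[]" X "[]" x False R] x by simp
    then show "pres_cong X R `` {[(x, False)]} \<otimes>\<^bsub>presented_group X R\<^esub> pres_cong X R `` {[(x, True)]}
        = \<one>\<^bsub>presented_group X R\<^esub>"
      using equiv_class_eq[OF equiv_pres_cong] x
      by (simp add: presented_group_mult) (simp add: presented_group_def)
  qed (use x in \<open>auto intro!: presented_group_class_closed\<close>)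
  then have "(if b then pres_cong X R `` {[(x, True)]}
      else inv\<^bsub>presented_group X R\<^esub> (pres_cong X R `` {[(x, True)]})) = pres_cong X R `` {[(x, b)]}"
    by (cases b) auto
  then show ?case using x Cons.IH by (simp add: y word_eval_Cons presented_group_mult)
qed

lemma GM_relations_GM:
  fixes M :: "int mat"
  defines "cls \<equiv> \<lambda>x. pres_cong (GM_gens (dim_row M)) (GM_rels M) `` {[(x, True)]}"
  shows "GM_relations (GM M) (\<lambda>i. cls (Agen i)) (cls Tgen) (dim_row M) M"
    and "carrier (GM M) = generate (GM M) ((\<lambda>i. cls (Agen i)) ` {..<dim_row M} \<union> {cls Tgen})"
proof -
  let ?X = "GM_gens (dim_row M)" and ?R = "GM_rels M" and ?r = "dim_row M"
  have G: "GM M = presented_group ?X ?R" by (simp add: GM_def)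
  interpret group "GM M" unfolding G by (rule group_presented_group)
  have X: "Agen i \<in> ?X \<longleftrightarrow> i < ?r" "Tgen \<in> ?X" for i by (auto simp: GM_gens_def)
  have cls: "cls x \<in> carrier (GM M)" if "x \<in> ?X" for x
    using that by (auto simp: cls_def G intro: presented_group_class_closed)
  have ev: "word_eval (GM M) cls w = pres_cong ?X ?R `` {w}" if "w \<in> gwords ?X" for w
    using word_eval_presented_group[OF that] by (simp add: cls_def G)
  have rel: "word_eval (GM M) cls u = word_eval (GM M) cls v"
    if "(u, v) \<in> ?R" "u \<in> gwords ?X" "v \<in> gwords ?X" for u v
  proof -
    have "(u, v) \<in> pres_cong ?X ?R"
      using pres_cong.rel[of "[]" ?X "[]" u v ?R] that by simp
    then show ?thesis using equiv_class_eq[OF equiv_pres_cong] that by (simp add: ev)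
  qed
  have comm: "cls (Agen i) \<otimes>\<^bsub>GM M\<^esub> cls (Agen j) = cls (Agen j) \<otimes>\<^bsub>GM M\<^esub> cls (Agen i)"
    if "i < j" "j < ?r" for i j
  proof -
    have "([(Agen i, True), (Agen j, True)], [(Agen j, True), (Agen i, True)]) \<in> ?R"
      using that by (auto simp: GM_rels_def)
    from rel[OF this] show ?thesis using that by (simp add: X word_eval_Cons word_eval_Nil cls)
  qed
  show "GM_relations (GM M) (\<lambda>i. cls (Agen i)) (cls Tgen) ?r M"
  proof
    fix i assume i: "i < ?r"
    show "cls (Agen i) \<in> carrier (GM M)" using i by (simp add: cls X)
    let ?w = "concat (map (\<lambda>j. gword_power (Agen j) (M $$ (i, j))) [0..<?r])"
    have w: "word_eval (GM M) cls ?w = pow_prod (GM M) (\<lambda>j. cls (Agen j)) ?r (\<lambda>j. M $$ (i, j))"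
      "?w \<in> gwords ?X"
      using word_eval_pow_prod[of ?X cls ?r Agen "\<lambda>j. M $$ (i, j)"] cls by (auto simp: X)
    have "([(Tgen, False), (Agen i, True), (Tgen, True)], ?w) \<in> ?R"
      using i by (auto simp: GM_rels_def)
    from rel[OF this] w i
    show "inv\<^bsub>GM M\<^esub> cls Tgen \<otimes>\<^bsub>GM M\<^esub> cls (Agen i) \<otimes>\<^bsub>GM M\<^esub> cls Tgen =
        pow_prod (GM M) (\<lambda>j. cls (Agen j)) ?r (\<lambda>j. M $$ (i, j))"
      by (simp add: X word_eval_Cons word_eval_Nil cls m_assoc)
  next
    show "cls Tgen \<in> carrier (GM M)" by (simp add: cls X)
  next
    fix i j assume "i < ?r" "j < ?r"
    \<comment> \<open>The presentation lists the commutation relations for \<open>i < j\<close>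
      only.\<close>
    then show "cls (Agen i) \<otimes>\<^bsub>GM M\<^esub> cls (Agen j) = cls (Agen j) \<otimes>\<^bsub>GM M\<^esub> cls (Agen i)"
      using comm[of i j] comm[of j i] by (cases i j rule: linorder_cases) auto
  qed
  let ?S = "(\<lambda>i. cls (Agen i)) ` {..<?r} \<union> {cls Tgen}"
  have S: "cls x \<in> ?S" if "x \<in> ?X" for x using that by (auto simp: GM_gens_def)
  have SG: "?S \<subseteq> carrier (GM M)" using cls by (auto simp: X)
  have "word_eval (GM M) cls w \<in> generate (GM M) ?S" if "w \<in> gwords ?X" for w
    using that
  proof (induction w)
    case Nil
    then show ?case by (simp add: word_eval_Nil generate.one)
  next
    case (Cons y w)
    obtain x b where y: "y = (x, b)" by (cases y)
    have "x \<in> ?X" using Cons.prems by (simp add: y)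
    then have "(if b then cls x else inv\<^bsub>GM M\<^esub> cls x) \<in> generate (GM M) ?S"
      using S generate.incl generate.inv by (metis (no_types, lifting))
    moreover have "word_eval (GM M) cls w \<in> generate (GM M) ?S" using Cons by (simp add: y)
    ultimately show ?case by (simp add: y word_eval_Cons generate.eng)
  qed
  moreover have "\<exists>w\<in>gwords ?X. x = pres_cong ?X ?R `` {w}" if "x \<in> carrier (GM M)" for x
    using that by (auto simp: G presented_group_def quotient_def)
  ultimately have "carrier (GM M) \<subseteq> generate (GM M) ?S" by (auto simp: ev)
  then show "carrier (GM M) = generate (GM M) ?S"
    using generate_incl[OF SG] by blast
qed

section \<open>The action of the group on the tree\<close>

text \<open>The extra coordinate \<open>r\<close> will make the affine map \<open>x \<mapsto> T x + e\<^sub>r\<close> representing \<open>t\<^sup>-\<^sup>1\<close> one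
  of infinite order.\<close>

definition lmul_ext :: "nat \<Rightarrow> int mat \<Rightarrow> ivec \<Rightarrow> ivec" where
  "lmul_ext r M x = (\<lambda>j. if j < r then lmul r M x j else x j)"

lemma lmul_ext_add: "lmul_ext r M (x + y) = lmul_ext r M x + lmul_ext r M y"
  by (auto simp: lmul_ext_def lmul_def pointwise distrib_right sum.distrib)

lemma lmul_ext_ivecs: "lmul_ext r M ` ivecs (Suc r) \<subseteq> ivecs (Suc r)"
  by (auto simp: lmul_ext_def ivecs_def)

text \<open>Modulo \<open>p\<close> the matrix only permutes coordinates: coordinate
  \<open>\<pi> j\<close> of the image of \<open>z\<close> is congruent to coordinate
  \<open>j\<close> of \<open>z\<close>, where \<open>\<pi>\<close> is \<open>\<sigma>\<close> on
  indices from 0. From \<open>r\<close> on coordinates are fixed. After \<open>q\<close> iterations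
  \<open>\<pi>\<close> has returned to the identity.\<close>

lemma lmul_ext_periodic:
  assumes N: "N \<in> carrier_mat r r" and \<sigma>: "\<sigma> \<in> carrier (sym_group r)"
    and ord: "group.ord (sym_group r) \<sigma> = q"
    and M: "M = int p \<cdot>\<^sub>m N + perm_matrix r \<sigma>"
  shows "int p dvd (lmul_ext r M ^^ q) x j - x j"
proof -
  interpret S: group "sym_group r" by (rule sym_group_is_group)
  have perm: "\<sigma> permutes {1..r}" using \<sigma> by (simp add: sym_group_carrier)
  have M_entry: "M $$ (i, j) = int p * N $$ (i, j) + (if \<sigma> (Suc i) = Suc j then 1 else 0)"
    if "i < r" "j < r" for i j
    using that N by (auto simp: M perm_matrix_def)
  \<comment> \<open>\<open>\<sigma>\<close> fixes 0 and is injective, so the subtraction never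
    truncates.\<close>
  define \<pi> where "\<pi> j = \<sigma> (Suc j) - 1" for j
  have \<sigma>0: "\<sigma> 0 = 0" using permutes_not_in[OF perm, of 0] by simp
  then have "\<sigma> (Suc j) \<noteq> 0" for j
    using permutes_inj[OF perm] by (metis injD nat.distinct(1))
  then have \<sigma>_Suc: "\<sigma> (Suc j) = Suc (\<pi> j)" for j
    by (simp add: \<pi>_def)
  have \<pi>_lt: "\<pi> j < r \<longleftrightarrow> j < r" for j
    using permutes_in_image[OF perm, of "Suc j"] by (simp add: \<sigma>_Suc Suc_le_eq)
  have step: "int p dvd lmul_ext r M z (\<pi> j) - z j" for z j
  proof (cases "j < r")
    case True
    have "lmul_ext r M z (\<pi> j) = (\<Sum>i<r. int p * (z i * N $$ (i, \<pi> j)) + (if i = j then z i else 0))"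
      using True permutes_inj[OF perm]
      by (auto simp: lmul_ext_def lmul_def \<pi>_lt M_entry algebra_simps \<sigma>_Suc[symmetric] inj_eq intro!: sum.cong)
    also have "\<dots> = int p * (\<Sum>i<r. z i * N $$ (i, \<pi> j)) + z j"
      using True by (simp add: sum.distrib sum_distrib_left)
    finally show ?thesis by simp
  next
    case False
    then have "\<sigma> (Suc j) = Suc j" by (intro permutes_not_in[OF perm]) auto
    then show ?thesis using False by (simp add: lmul_ext_def \<pi>_def)
  qed
  have pow: "int p dvd (lmul_ext r M ^^ n) x ((\<pi> ^^ n) j) - x j" for n
  proof (induction n)
    case (Suc n)
    have "int p dvd lmul_ext r M ((lmul_ext r M ^^ n) x) (\<pi> ((\<pi> ^^ n) j)) - (lmul_ext r M ^^ n) x ((\<pi> ^^ n) j)"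
      by (rule step)
    from dvd_add[OF this Suc] show ?case by simp
  qed simp
  have "\<sigma> [^]\<^bsub>sym_group r\<^esub> n = \<sigma> ^^ n" for n :: nat
    by (induction n) (simp_all add: sym_group_one sym_group_mult funpow_Suc_right del: funpow.simps(2))
  then have "\<sigma> ^^ q = id"
    using S.pow_ord_eq_1[OF \<sigma>] ord by (simp add: sym_group_one)
  moreover have "(\<sigma> ^^ n) (Suc j) = Suc ((\<pi> ^^ n) j)" for n
    by (induction n) (simp_all add: \<sigma>_Suc)
  ultimately have "(\<pi> ^^ q) j = j" by (metis id_apply nat.inject)
  then show ?thesis using pow[of q] by simp
qed

lemma lattice_chain_exists:
  assumes "prime p" and "N \<in> carrier_mat r r" and "\<sigma> \<in> carrier (sym_group r)"
    and "group.ord (sym_group r) \<sigma> = p ^ m" and "M = int p \<cdot>\<^sub>m N + perm_matrix r \<sigma>"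
  shows "\<exists>K F \<beta>. lattice_chain p K (Suc r) (lmul_ext r M) F \<beta>"
proof -
  let ?V = "ivecs (Suc r)" and ?T = "lmul_ext r M"
  have p: "p > 0" "p > 1" using prime_gt_0_nat[OF assms(1)] prime_gt_1_nat[OF assms(1)] by auto
  have "(*) (of_nat p) ` ?V \<subseteq> ?V" using add_subgroup_of_nat_mult[OF add_subgroup_ivecs] by blast
  then have V: "?V \<in> intermediate_subgroups p (Suc r)"
    by (simp add: intermediate_subgroups_def add_subgroup_ivecs)
  have nilp: "((\<lambda>y. ?T y - y) ^^ (p ^ m)) x \<in> (*) (of_nat p) ` ?V" if "x \<in> ?V" for x
    by (rule funpow_diff_id_in_scaled[OF assms(1) lmul_ext_add lmul_ext_ivecs that
        lmul_ext_periodic[OF assms(2-5)]])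
  have "\<exists>K F \<beta>. F 0 = ?V \<and> F K = (*) (of_nat p) ` ?V \<and>
      (\<forall>n\<le>K. F n \<in> intermediate_subgroups p (Suc r)) \<and>
      (\<forall>n<K. filtration_step p ?T (F n) (F (Suc n)) (\<beta> n))"
    by (rule filtration_exists[OF p(1) V lmul_ext_add lmul_ext_ivecs lmul_ext_ivecs, where q = "p ^ m"])
      (rule nilp)
  then obtain K F \<beta> where F: "F 0 = ?V" "F K = (*) (of_nat p) ` ?V"
    "\<forall>n\<le>K. F n \<in> intermediate_subgroups p (Suc r)"
    "\<forall>n<K. filtration_step p ?T (F n) (F (Suc n)) (\<beta> n)"
    by (elim exE conjE)
  \<comment> \<open>The first unit vector separates \<open>V\<close> from \<open>p V\<close>, so the
    period has positive length.\<close>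
  have "(\<lambda>j. if j = 0 then 1 else 0) \<in> ?V" by (auto simp: ivecs_def)
  moreover have "(\<lambda>j. if j = 0 then 1 else 0) \<notin> (*) (of_nat p) ` ?V"
    using p(2) by (auto simp: scaled_ivecs_iff[OF p(1)] intro!: exI[of _ 0])
  ultimately have "K \<noteq> 0" using F(1,2) by metis
  then have "lattice_chain p K (Suc r) ?T F \<beta>"
    using F assms(1) by unfold_locales (auto simp: lmul_ext_add)
  then show ?thesis by blast
qed

section \<open>Permutations of words induced by maps of the lattice\<close>

context lattice_chain
begin

abbreviation perm_group :: "(nat list \<Rightarrow> nat list) monoid" where
  "perm_group \<equiv> BijGroup (lists {..<p})"

text \<open>The permutation \<open>g\<close> of the words is induced by the self-map \<open>\<phi>\<close> of the lattice, words of
  length \<open>n\<close> standing for the cosets of \<open>level n\<close>.\<close>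

definition acts :: "(nat list \<Rightarrow> nat list) \<Rightarrow> (ivec \<Rightarrow> ivec) \<Rightarrow> bool" where
  "acts g \<phi> \<longleftrightarrow> g \<in> carrier perm_group \<and>
    (\<forall>w\<in>lists {..<p}. length (g w) = length w \<and> val 0 (g w) - \<phi> (val 0 w) \<in> level (length w))"

text \<open>Such a \<open>\<phi>\<close> acts on the cosets of every level. Composition asks this of
  the outer map, since a word determines a vector only modulo a level.\<close>

definition level_cong :: "(ivec \<Rightarrow> ivec) \<Rightarrow> bool" where
  "level_cong \<phi> \<longleftrightarrow> (\<forall>n x y. x - y \<in> level n \<longrightarrow> \<phi> x - \<phi> y \<in> level n)"

lemma acts_closed: "acts g \<phi> \<Longrightarrow> g \<in> carrier perm_group"
  by (simp add: acts_def)

lemma acts_length: "acts g \<phi> \<Longrightarrow> w \<in> lists {..<p} \<Longrightarrow> length (g w) = length w"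
  unfolding acts_def by blast

lemma acts_val:
  "acts g \<phi> \<Longrightarrow> w \<in> lists {..<p} \<Longrightarrow> val 0 (g w) - \<phi> (val 0 w) \<in> level (length w)"
  unfolding acts_def by blast

lemma acts_mult:
  assumes "acts g \<phi>" "acts h \<psi>" "level_cong \<phi>"
  shows "acts (g \<otimes>\<^bsub>perm_group\<^esub> h) (\<lambda>x. \<phi> (\<psi> x))"
  unfolding acts_def
proof (intro conjI ballI)
  interpret group perm_group by (rule group_BijGroup)
  have c: "g \<in> carrier perm_group" "h \<in> carrier perm_group" using assms by (auto simp: acts_def)
  then show "g \<otimes>\<^bsub>perm_group\<^esub> h \<in> carrier perm_group" by simp
  fix w assume w: "w \<in> lists {..<p}"
  have hw: "h w \<in> lists {..<p}" "length (h w) = length w" "val 0 (h w) - \<psi> (val 0 w) \<in> level (length w)"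
    using BijGroup_apply_in[OF c(2) w] acts_length[OF assms(2) w] acts_val[OF assms(2) w] by auto
  have gh: "length (g (h w)) = length (h w)" "val 0 (g (h w)) - \<phi> (val 0 (h w)) \<in> level (length w)"
    using acts_length[OF assms(1) hw(1)] acts_val[OF assms(1) hw(1)] by (simp_all only: hw(2))
  show "length ((g \<otimes>\<^bsub>perm_group\<^esub> h) w) = length w"
    using c w gh hw by (simp add: BijGroup_mult_apply)
  have "\<phi> (val 0 (h w)) - \<phi> (\<psi> (val 0 w)) \<in> level (length w)"
    using assms(3) hw(3) by (auto simp: level_cong_def)
  from add_subgroup_add[OF level_subgroup gh(2) this]
  show "val 0 ((g \<otimes>\<^bsub>perm_group\<^esub> h) w) - \<phi> (\<psi> (val 0 w)) \<in> level (length w)"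
    using c w by (simp add: BijGroup_mult_apply)
qed

lemma acts_one: "acts \<one>\<^bsub>perm_group\<^esub> (\<lambda>x. x)"
  using group.is_monoid[OF group_BijGroup, of "lists {..<p}"] monoid.one_closed
  by (auto simp: acts_def BijGroup_one_apply add_subgroup_0[OF level_subgroup])

text \<open>By \<open>val_inj\<close> a word is determined by its length and its coset. Identities
  between permutations thus reduce to identities between affine maps.\<close>

lemma acts_unique:
  assumes "acts g \<phi>" "acts h \<phi>"
  shows "g = h"
proof (rule extensionalityI)
  show "g \<in> extensional (lists {..<p})" "h \<in> extensional (lists {..<p})"
    using assms Bij_imp_extensional by (auto simp: acts_def BijGroup_def)
  fix w assume w: "w \<in> lists {..<p}"
  have g: "val 0 (g w) - \<phi> (val 0 w) \<in> level (length w)" "length (g w) = length w"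
    and h: "val 0 (h w) - \<phi> (val 0 w) \<in> level (length w)" "length (h w) = length w"
    using acts_length[OF assms(1) w] acts_val[OF assms(1) w] acts_length[OF assms(2) w]
      acts_val[OF assms(2) w] by auto
  show "g w = h w"
  proof (rule val_inj[where n = 0])
    show "g w \<in> lists {..<p}" "h w \<in> lists {..<p}"
      using BijGroup_apply_in[OF acts_closed w] assms by blast+
    show "val 0 (g w) - val 0 (h w) \<in> level (0 + length (g w))"
      using add_subgroup_diff[OF level_subgroup g(1) h(1)] g by simp
  qed (use g h in simp)
qed

text \<open>Words of zeros stand for the zero vector at every level, so the two values agree modulo
  every level, and the levels intersect in \<open>{0}\<close>. Faithfulness rests on this.\<close>

lemma acts_agree:
  assumes "acts g \<phi>" "acts g \<psi>"
  shows "\<phi> 0 = \<psi> 0"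
proof -
  have "\<phi> 0 - \<psi> 0 \<in> level n" for n
  proof -
    let ?w = "replicate n 0"
    have "?w \<in> lists {..<p}" using p_gt_1 by auto
    then have "val 0 (g ?w) - \<phi> 0 \<in> level n" "val 0 (g ?w) - \<psi> 0 \<in> level n"
      using acts_val[OF assms(1), of ?w] acts_val[OF assms(2), of ?w]
      by (simp_all only: val_replicate_0 length_replicate)
    from add_subgroup_diff[OF level_subgroup this(2,1)] show ?thesis by simp
  qed
  then have "\<phi> 0 - \<psi> 0 = 0" by (rule level_Inter)
  then show ?thesis by simp
qed

lemma level_cong_translation: "level_cong (\<lambda>x. x + v)"
  by (simp add: level_cong_def)

lemma level_cong_lin: "level_cong (\<lambda>x. lin c x + v)"
proof -
  have "lin c x + v - (lin c y + v) = lin c (x - y)" for x y by (simp add: lin_def T_diff)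
  then show ?thesis using lin_level by (simp only: level_cong_def) blast
qed

lemma acts_inv:
  assumes "acts g (\<lambda>x. x + v)"
  shows "acts (inv\<^bsub>perm_group\<^esub> g) (\<lambda>x. x + - v)"
  unfolding acts_def
proof (intro conjI ballI)
  interpret group perm_group by (rule group_BijGroup)
  have c: "g \<in> carrier perm_group" using assms by (rule acts_closed)
  then show i: "inv\<^bsub>perm_group\<^esub> g \<in> carrier perm_group" by simp
  fix w assume w: "w \<in> lists {..<p}"
  define u where "u = (inv\<^bsub>perm_group\<^esub> g) w"
  have u: "u \<in> lists {..<p}" unfolding u_def using i w by (rule BijGroup_apply_in)
  have gu: "g u = w"
    using BijGroup_mult_apply[OF c i w] r_inv[OF c] BijGroup_one_apply[OF w] by (simp add: u_def)
  then have *: "length u = length w" "val 0 w - (val 0 u + v) \<in> level (length w)"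
    using acts_length[OF assms u] acts_val[OF assms u] by (simp_all only: gu)
  then show "length ((inv\<^bsub>perm_group\<^esub> g) w) = length w" by (simp add: u_def)
  show "val 0 ((inv\<^bsub>perm_group\<^esub> g) w) - (val 0 w + - v) \<in> level (length w)"
    using add_subgroup_uminus[OF level_subgroup *(2)] by (simp add: u_def[symmetric] algebra_simps)
qed

lemma acts_nat_pow:
  assumes "acts g \<phi>" "level_cong \<phi>"
  shows "acts (g [^]\<^bsub>perm_group\<^esub> (n :: nat)) (\<phi> ^^ n) \<and> level_cong (\<phi> ^^ n)"
proof (induction n)
  case 0
  then show ?case using acts_one by (simp add: level_cong_def id_def)
next
  case (Suc n)
  then have "acts (g [^]\<^bsub>perm_group\<^esub> n \<otimes>\<^bsub>perm_group\<^esub> g) (\<lambda>x. (\<phi> ^^ n) (\<phi> x))"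
    using assms by (intro acts_mult) auto
  moreover have "level_cong (\<phi> ^^ Suc n)"
    using Suc assms(2) by (simp add: level_cong_def)
  moreover have "(\<lambda>x. (\<phi> ^^ n) (\<phi> x)) = \<phi> ^^ Suc n"
    by (simp only: funpow_Suc_right comp_def)
  ultimately show ?case by (simp only: nat_pow_Suc)
qed

lemma acts_int_pow:
  assumes "acts g (\<lambda>x. x + v)"
  shows "acts (g [^]\<^bsub>perm_group\<^esub> (k :: int)) (\<lambda>x. x + of_int k * v)"
proof -
  interpret group perm_group by (rule group_BijGroup)
  have f: "(\<lambda>x. x + v) ^^ n = (\<lambda>x. x + of_nat n * v)" for n
    by (induction n) (simp_all add: fun_eq_iff[of "\<lambda>x. x + v"] distrib_right add_ac comp_def id_def)
  have nat: "acts (g [^]\<^bsub>perm_group\<^esub> n) (\<lambda>x. x + of_nat n * v)" for n :: nat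
    using acts_nat_pow[OF assms level_cong_translation, of n] by (simp add: f)
  show ?thesis
  proof (cases k rule: int_cases2)
    case (nonneg n)
    then show ?thesis using nat by (simp add: int_pow_int)
  next
    case (nonpos n)
    then show ?thesis
      using acts_inv[OF nat[of n]] acts_closed[OF assms] by (simp add: int_pow_neg_int)
  qed
qed

lemma acts_pow_prod:
  assumes "\<And>i. i < n \<Longrightarrow> acts (a i) (\<lambda>x. x + (\<lambda>j. if j = i then 1 else 0))"
  shows "acts (pow_prod perm_group a n v) (\<lambda>x. x + (\<lambda>j. if j < n then v j else 0))"
  using assms
proof (induction n)
  case 0
  have "(\<lambda>x. x + (\<lambda>j. if j < 0 then v j else 0)) = (\<lambda>x. x :: ivec)"
    by (simp add: fun_eq_iff pointwise)
  then show ?case using acts_one by (simp only: pow_prod.simps)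
next
  case (Suc n)
  have "acts (pow_prod perm_group a n v \<otimes>\<^bsub>perm_group\<^esub> a n [^]\<^bsub>perm_group\<^esub> v n)
     (\<lambda>x. x + of_int (v n) * (\<lambda>j. if j = n then 1 else 0) + (\<lambda>j. if j < n then v j else 0))"
    using Suc by (intro acts_mult acts_int_pow level_cong_translation) auto
  moreover have "(\<lambda>x. x + of_int (v n) * (\<lambda>j. if j = n then 1 else 0) + (\<lambda>j. if j < n then v j else 0)) =
      (\<lambda>x. x + (\<lambda>j. if j < Suc n then v j else 0))"
    by (auto simp: fun_eq_iff pointwise less_Suc_eq)
  ultimately show ?case by (simp only: pow_prod.simps)
qed

lemma acts_autom_perm:
  assumes "(c, 0, v) \<in> chain_states"
  shows "acts (autom_perm chain_automaton (c, 0, v)) (\<lambda>x. lin c x + v)"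
  unfolding acts_def
proof (intro conjI ballI)
  show "autom_perm chain_automaton (c, 0, v) \<in> carrier perm_group"
    using autom_perm_in_BijGroup[of chain_automaton "(c, 0, v)"] p_automaton_chain_automaton assms
    by (simp add: p_automaton_def chain_automaton_def)
  fix w assume w: "w \<in> lists {..<p}"
  have eq: "autom_perm chain_automaton (c, 0, v) w = out_word chain_automaton (c, 0, v) w"
    using w by (simp add: autom_perm_def chain_automaton_def)
  show "length (autom_perm chain_automaton (c, 0, v) w) = length w" by (simp add: eq)
  show "val 0 (autom_perm chain_automaton (c, 0, v) w) - (lin c (val 0 w) + v) \<in> level (length w)"
    using out_word_chain_automaton[OF assms w] by (simp add: eq)
qed

end

section \<open>The isomorphism of G_M with the group of the automaton\<close>

abbreviation unit_ivec :: "nat \<Rightarrow> ivec" where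
  "unit_ivec i \<equiv> (\<lambda>j. if j = i then 1 else 0)"

locale GM_chain = lattice_chain p K "Suc r" "lmul_ext r M" F \<beta> for p K r M F \<beta> +
  assumes dim_M: "dim_row M = r"
begin

definition \<alpha> :: "nat \<Rightarrow> nat list \<Rightarrow> nat list" where
  "\<alpha> i = autom_perm chain_automaton (False, 0, unit_ivec i)"

definition \<tau> :: "nat list \<Rightarrow> nat list" where
  "\<tau> = autom_perm chain_automaton (True, 0, unit_ivec r)"

lemma unit_state: "i \<le> r \<Longrightarrow> (c, 0, unit_ivec i) \<in> chain_states"
proof -
  assume "i \<le> r"
  moreover have "1 \<le> growth * int K"
    using mult_mono[of 1 growth 1 "int K"] growth_pos K_pos by simp
  ultimately show ?thesis
    using K_pos growth_pos by (auto simp: chain_states_def F_0 ivecs_def)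
qed

lemma acts_\<alpha>: "i < r \<Longrightarrow> acts (\<alpha> i) (\<lambda>x. x + unit_ivec i)"
  using acts_autom_perm[OF unit_state[of i False]] by (simp add: \<alpha>_def lin_def)

lemma acts_\<tau>: "acts \<tau> (\<lambda>x. lmul_ext r M x + unit_ivec r)"
  using acts_autom_perm[OF unit_state[of r True]] by (simp add: \<tau>_def lin_def)

lemma acts_prod_\<alpha>: "acts (pow_prod perm_group \<alpha> r v) (\<lambda>x. x + (\<lambda>j. if j < r then v j else 0))"
  by (intro acts_pow_prod acts_\<alpha>)

lemma level_cong_\<tau>: "level_cong (\<lambda>x. lmul_ext r M x + unit_ivec r)"
  using level_cong_lin[of True "unit_ivec r"] by (simp add: lin_def)

lemma lmul_ext_unit: "i < r \<Longrightarrow> lmul_ext r M (unit_ivec i) = (\<lambda>j. if j < r then M $$ (i, j) else 0)"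
  by (auto simp: lmul_ext_def lmul_def if_distrib[of "\<lambda>x. x * _"] cong: if_cong)

text \<open>Applying the affine map of \<open>\<tau>\<close> after the translation by unit vector
  \<open>i\<close> equals applying it before the translation by row \<open>i\<close> of
  \<open>M\<close>. So \<open>\<tau> \<alpha>_i \<tau>^-1\<close> is the latter translation, and the
  inverse of \<open>\<tau>\<close> takes the place of \<open>t\<close>.\<close>

lemma GM_relations_perm_group: "GM_relations perm_group \<alpha> (inv\<^bsub>perm_group\<^esub> \<tau>) r M"
proof -
  interpret group perm_group by (rule group_BijGroup)
  have \<tau>: "\<tau> \<in> carrier perm_group" using acts_\<tau> by (rule acts_closed)
  have \<alpha>: "\<alpha> i \<in> carrier perm_group" if "i < r" for i using acts_\<alpha>[OF that] by (rule acts_closed)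
  show ?thesis
  proof
    fix i assume i: "i < r"
    let ?P = "pow_prod perm_group \<alpha> r (\<lambda>j. M $$ (i, j))"
    show "\<alpha> i \<in> carrier perm_group" using \<alpha> i .
    have P: "?P \<in> carrier perm_group" using acts_prod_\<alpha> by (rule acts_closed)
    have "acts (\<tau> \<otimes>\<^bsub>perm_group\<^esub> \<alpha> i) (\<lambda>x. lmul_ext r M (x + unit_ivec i) + unit_ivec r)"
      using i by (intro acts_mult[OF acts_\<tau>] acts_\<alpha> level_cong_\<tau>)
    moreover have "acts (?P \<otimes>\<^bsub>perm_group\<^esub> \<tau>)
        (\<lambda>x. lmul_ext r M x + unit_ivec r + (\<lambda>j. if j < r then M $$ (i, j) else 0))"
      by (intro acts_mult[OF acts_prod_\<alpha>] acts_\<tau> level_cong_translation)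
    moreover have "(\<lambda>x. lmul_ext r M (x + unit_ivec i) + unit_ivec r) =
        (\<lambda>x. lmul_ext r M x + unit_ivec r + (\<lambda>j. if j < r then M $$ (i, j) else 0))"
      by (simp only: T_add lmul_ext_unit[OF i] add_ac)
    ultimately have "\<tau> \<otimes>\<^bsub>perm_group\<^esub> \<alpha> i = ?P \<otimes>\<^bsub>perm_group\<^esub> \<tau>"
      by (simp only:) (rule acts_unique)
    then show "inv\<^bsub>perm_group\<^esub> (inv\<^bsub>perm_group\<^esub> \<tau>) \<otimes>\<^bsub>perm_group\<^esub> \<alpha> i \<otimes>\<^bsub>perm_group\<^esub> inv\<^bsub>perm_group\<^esub> \<tau> = ?P"
      using \<tau> P \<alpha>[OF i] by (simp add: m_assoc)
  next
    show "inv\<^bsub>perm_group\<^esub> \<tau> \<in> carrier perm_group" using \<tau> by simp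
  next
    fix i j assume "i < r" "j < r"
    then have "acts (\<alpha> i \<otimes>\<^bsub>perm_group\<^esub> \<alpha> j) (\<lambda>x. x + unit_ivec j + unit_ivec i)"
      and "acts (\<alpha> j \<otimes>\<^bsub>perm_group\<^esub> \<alpha> i) (\<lambda>x. x + unit_ivec i + unit_ivec j)"
      using acts_mult[OF acts_\<alpha> acts_\<alpha> level_cong_translation] by blast+
    moreover have "(\<lambda>x. x + unit_ivec j + unit_ivec i) = (\<lambda>x. x + unit_ivec i + unit_ivec j)"
      by (simp only: add_ac)
    ultimately show "\<alpha> i \<otimes>\<^bsub>perm_group\<^esub> \<alpha> j = \<alpha> j \<otimes>\<^bsub>perm_group\<^esub> \<alpha> i"
      by (simp only:) (rule acts_unique)
  qed
qed

text \<open>\<open>T\<close> fixes the last coordinate and each application adds 1 to it, which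
  records the exponent of \<open>\<tau>\<close>.\<close>

lemma funpow_\<tau>_coordinate: "((\<lambda>x. lmul_ext r M x + unit_ivec r) ^^ n) 0 r = int n"
proof -
  have "(((\<lambda>x. lmul_ext r M x + unit_ivec r) ^^ n) x) r = x r + int n" for x
    by (induction n) (simp_all add: pointwise lmul_ext_def)
  then show ?thesis by (simp add: pointwise)
qed

text \<open>The maps inducing the two sides are compared at 0. The translation leaves coordinate
  \<open>r\<close> alone, so this coordinate gives \<open>m = n\<close>; then the translation vector
  must vanish.\<close>

lemma pow_prod_\<alpha>_\<tau>:
  assumes "pow_prod perm_group \<alpha> r v \<otimes>\<^bsub>perm_group\<^esub> \<tau> [^]\<^bsub>perm_group\<^esub> (m :: nat) = \<tau> [^]\<^bsub>perm_group\<^esub> (n :: nat)"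
  shows "m = n" "i < r \<Longrightarrow> v i = 0"
proof -
  let ?v = "\<lambda>j. if j < r then v j else 0" and ?\<psi> = "\<lambda>x. lmul_ext r M x + unit_ivec r"
  interpret group perm_group by (rule group_BijGroup)
  have pow: "acts (\<tau> [^]\<^bsub>perm_group\<^esub> k) (?\<psi> ^^ k)" for k :: nat
    using acts_nat_pow[OF acts_\<tau> level_cong_\<tau>] by blast
  have "acts (\<tau> [^]\<^bsub>perm_group\<^esub> n) (\<lambda>x. (?\<psi> ^^ m) x + ?v)"
    using acts_mult[OF acts_prod_\<alpha>[of v] pow[of m] level_cong_translation] assms by simp
  from acts_agree[OF this pow] have eq: "(?\<psi> ^^ m) 0 + ?v = (?\<psi> ^^ n) 0" .
  then have "((?\<psi> ^^ m) 0 + ?v) r = (?\<psi> ^^ n) 0 r" by simp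
  then show "m = n" by (simp add: funpow_\<tau>_coordinate pointwise)
  then have "?v = 0" using eq by simp
  then show "v i = 0" if "i < r" using fun_cong[of ?v 0 i] that by (simp add: pointwise)
qed

text \<open>Von Dyck's theorem provides the homomorphism; its injectivity is read off from normal
  forms.\<close>

lemma iso_GM: "GM M \<cong> subgroup_generated perm_group (\<alpha> ` {..<r} \<union> {\<tau>})"
proof -
  let ?\<tau>' = "inv\<^bsub>perm_group\<^esub> \<tau>"
  define cls where "cls x = pres_cong (GM_gens r) (GM_rels M) `` {[(x, True)]}" for x
  define S where "S = (\<lambda>i. cls (Agen i)) ` {..<r} \<union> {cls Tgen}"
  interpret B: GM_relations perm_group \<alpha> ?\<tau>' r M by (rule GM_relations_perm_group)
  interpret G: GM_relations "GM M" "\<lambda>i. cls (Agen i)" "cls Tgen" r M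
    using GM_relations_GM(1)[of M] by (simp add: cls_def dim_M)
  have gen: "carrier (GM M) = generate (GM M) S"
    using GM_relations_GM(2)[of M] by (simp add: cls_def dim_M S_def)
  have S: "S \<subseteq> carrier (GM M)" by (auto simp: S_def G.a_closed G.t_closed)
  have \<tau>: "\<tau> \<in> carrier perm_group" using acts_\<tau> by (rule acts_closed)
  define f where "f x = (case x of Agen i \<Rightarrow> \<alpha> i | Tgen \<Rightarrow> ?\<tau>')" for x
  have f: "f x \<in> carrier perm_group" if "x \<in> GM_gens r" for x
    using that \<tau> by (auto simp: f_def GM_gens_def B.a_closed)
  have "word_eval perm_group f u = word_eval perm_group f v" if "(u, v) \<in> GM_rels M" for u v
    using that unfolding GM_rels_def
  proof safe
    fix i j assume "i < j" "j < dim_row M"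
    then show "word_eval perm_group f [(Agen i, True), (Agen j, True)] =
        word_eval perm_group f [(Agen j, True), (Agen i, True)]"
      using B.a_commute[of i j] by (simp add: B.word_eval_Cons B.word_eval_Nil f_def B.a_closed dim_M)
  next
    fix i assume "i < dim_row M"
    then have i: "i < r" by (simp add: dim_M)
    have "word_eval perm_group f [(Tgen, False), (Agen i, True), (Tgen, True)] = \<tau> \<otimes>\<^bsub>perm_group\<^esub> \<alpha> i \<otimes>\<^bsub>perm_group\<^esub> ?\<tau>'"
      using i \<tau> by (simp add: B.word_eval_Cons B.word_eval_Nil f_def B.a_closed B.m_assoc)
    also have "\<dots> = pow_prod perm_group \<alpha> r (\<lambda>j. M $$ (i, j))"
      using B.a_conj[OF i] \<tau> by simp
    also have "\<dots> = word_eval perm_group f (concat (map (\<lambda>j. gword_power (Agen j) (M $$ (i, j))) [0..<dim_row M]))"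
      using B.word_eval_pow_prod[of "GM_gens r" f r Agen "\<lambda>j. M $$ (i, j)"] f
      by (simp add: dim_M) (simp add: GM_gens_def f_def)
    finally show "word_eval perm_group f [(Tgen, False), (Agen i, True), (Tgen, True)] =
        word_eval perm_group f (concat (map (\<lambda>j. gword_power (Agen j) (M $$ (i, j))) [0..<dim_row M]))" .
  qed
  then obtain h where h: "h \<in> hom (GM M) perm_group"
    "\<And>w. w \<in> gwords (GM_gens r) \<Longrightarrow> h (pres_cong (GM_gens r) (GM_rels M) `` {w}) = word_eval perm_group f w"
    using B.presented_group_hom[of "GM_gens r" f "GM_rels M"] f unfolding GM_def dim_M by blast
  have gens: "Agen i \<in> GM_gens r \<longleftrightarrow> i < r" "Tgen \<in> GM_gens r" for i
    by (auto simp: GM_gens_def)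
  interpret h: group_hom "GM M" perm_group h using h(1) by unfold_locales
  have ha: "h (cls (Agen i)) = \<alpha> i" if "i < r" for i
    using that by (simp add: cls_def h(2) gens B.word_eval_Cons B.word_eval_Nil f_def B.a_closed)
  have ht: "h (cls Tgen) = ?\<tau>'"
    using \<tau> by (simp add: cls_def h(2) gens B.word_eval_Cons B.word_eval_Nil f_def)
  have "inj_on h (carrier (GM M))"
    unfolding h.inj_on_one_iff
  proof (intro allI ballI impI)
    fix g assume g: "g \<in> carrier (GM M)" "h g = \<one>\<^bsub>perm_group\<^esub>"
    then have "g \<in> G.normal_forms"
      using G.generate_subset_normal_forms gen by (auto simp: S_def)
    then obtain n m :: nat and v where nf:
      "g = cls Tgen [^]\<^bsub>GM M\<^esub> n \<otimes>\<^bsub>GM M\<^esub> G.A r v \<otimes>\<^bsub>GM M\<^esub> inv\<^bsub>GM M\<^esub> (cls Tgen [^]\<^bsub>GM M\<^esub> m)"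
      unfolding G.normal_forms_def by blast
    let ?A = "pow_prod perm_group \<alpha> r v"
    have A: "?A \<in> carrier perm_group" by (simp add: B.A_closed)
    have "h (G.A r v) = pow_prod perm_group (\<lambda>i. h (cls (Agen i))) r v"
      by (rule h.hom_pow_prod) (rule G.a_closed)
    also have "\<dots> = ?A" by (rule pow_prod_cong) (simp_all add: ha)
    finally have hA: "h (G.A r v) = ?A" .
    have pow: "h (cls Tgen [^]\<^bsub>GM M\<^esub> k) = inv\<^bsub>perm_group\<^esub> (\<tau> [^]\<^bsub>perm_group\<^esub> k)" for k :: nat
      using \<tau> by (simp add: h.hom_nat_pow ht G.t_closed B.nat_pow_inv)
    \<comment> \<open>As \<open>t\<close> goes to the inverse of \<open>\<tau>\<close>, the normal
      form \<open>t^n A t^-m\<close> goes to \<open>\<tau>^-n A \<tau>^m\<close>; triviality means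
      \<open>A \<tau>^m = \<tau>^n\<close>.\<close>
    have "h g = inv\<^bsub>perm_group\<^esub> (\<tau> [^]\<^bsub>perm_group\<^esub> n) \<otimes>\<^bsub>perm_group\<^esub> ?A \<otimes>\<^bsub>perm_group\<^esub> \<tau> [^]\<^bsub>perm_group\<^esub> m"
      using \<tau> by (simp add: nf pow hA G.A_closed G.t_closed)
    then have "inv\<^bsub>perm_group\<^esub> (\<tau> [^]\<^bsub>perm_group\<^esub> n) \<otimes>\<^bsub>perm_group\<^esub> (?A \<otimes>\<^bsub>perm_group\<^esub> \<tau> [^]\<^bsub>perm_group\<^esub> m) = \<one>\<^bsub>perm_group\<^esub>"
      using g(2) A \<tau> by (simp add: B.m_assoc)
    then have "?A \<otimes>\<^bsub>perm_group\<^esub> \<tau> [^]\<^bsub>perm_group\<^esub> m = \<tau> [^]\<^bsub>perm_group\<^esub> n"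
      using A \<tau> by (metis B.inv_closed B.inv_equality B.inv_inv B.m_closed B.nat_pow_closed)
    note * = pow_prod_\<alpha>_\<tau>[OF this]
    have "G.A r v = G.A r 0" by (rule pow_prod_cong) (simp_all add: *(2) pointwise)
    then show "g = \<one>\<^bsub>GM M\<^esub>" using *(1) by (simp add: nf G.A_0 G.t_closed)
  qed
  moreover have "h ` carrier (GM M) = generate perm_group (\<alpha> ` {..<r} \<union> {\<tau>})"
  proof -
    have "h ` carrier (GM M) = generate perm_group (h ` S)"
      unfolding gen using h.generate_img[OF S] by simp
    also have "h ` S = \<alpha> ` {..<r} \<union> {?\<tau>'}" by (auto simp: S_def ha ht image_Un image_image)
    also have "generate perm_group (\<alpha> ` {..<r} \<union> {?\<tau>'}) = generate perm_group (\<alpha> ` {..<r} \<union> {\<tau>})"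
    proof (intro equalityI B.generate_subgroup_incl B.generate_is_subgroup)
      have "inv\<^bsub>perm_group\<^esub> ?\<tau>' \<in> generate perm_group (\<alpha> ` {..<r} \<union> {?\<tau>'})"
        by (intro generate.inv) simp
      then show "\<alpha> ` {..<r} \<union> {\<tau>} \<subseteq> generate perm_group (\<alpha> ` {..<r} \<union> {?\<tau>'})"
        using \<tau> by (auto intro: generate.incl)
      show "\<alpha> ` {..<r} \<union> {?\<tau>'} \<subseteq> generate perm_group (\<alpha> ` {..<r} \<union> {\<tau>})"
        by (auto intro: generate.incl generate.inv)
    qed (use \<tau> B.a_closed in auto)
    finally show ?thesis .
  qed
  \<comment> \<open>\<open>subgroup_generated\<close> intersects the generating set with the
    carrier.\<close>
  moreover have "carrier perm_group \<inter> (\<alpha> ` {..<r} \<union> {\<tau>}) = \<alpha> ` {..<r} \<union> {\<tau>}"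
    using \<tau> B.a_closed by auto
  ultimately have "h \<in> iso (GM M) (subgroup_generated perm_group (\<alpha> ` {..<r} \<union> {\<tau>}))"
    using h.hom_mult
    by (auto simp: iso_def hom_def bij_betw_def carrier_subgroup_generated)
  then show ?thesis by (rule is_isoI)
qed

end

theorem theorem4:
  fixes p k r m :: nat and M N C :: "int mat" and \<sigma> :: "nat \<Rightarrow> nat"
  assumes "prime p" and "k \<ge> 1" and "r = p ^ k"
    and "N \<in> carrier_mat r r"
    and "\<sigma> \<in> carrier (sym_group r)" and "group.ord (sym_group r) \<sigma> = p ^ m"
    and "C = perm_matrix r \<sigma>"
    and "M = int p \<cdot>\<^sub>m N + C"
  shows "generated_by_finite_p_automaton p (GM M) \<and> residually_p_finite p (GM M)"
proof
  have dim: "dim_row M = r"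
    using assms(4,7,8) by (simp add: perm_matrix_def)
  obtain K F \<beta> where "lattice_chain p K (Suc r) (lmul_ext r M) F \<beta>"
    using lattice_chain_exists[OF assms(1,4,5,6), of M] assms(7,8) by blast
  then interpret GM_chain p K r M F \<beta>
    by (simp add: GM_chain_def GM_chain_axioms_def dim)
  \<comment> \<open>The states at position 0 whose permutations are the \<open>\<alpha> i\<close>
    and \<open>\<tau>\<close>; of all states only these are taken as generators.\<close>
  define S where "S = (\<lambda>i. (False, 0 :: nat, unit_ivec i)) ` {..<r} \<union> {(True, 0, unit_ivec r)}"
  have "S \<subseteq> states chain_automaton"
    using unit_state by (auto simp: S_def chain_automaton_def)
  then obtain A :: "(nat, nat) automaton" and S' where A: "p_automaton p A" "S' \<subseteq> states A"
    "alphabet A = alphabet chain_automaton" "autom_perm A ` S' = autom_perm chain_automaton ` S"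
    using p_automaton_nat_states[OF p_automaton_chain_automaton] by metis
  have "autom_perm chain_automaton ` S = \<alpha> ` {..<r} \<union> {\<tau>}"
    by (simp add: S_def image_Un image_image \<alpha>_def \<tau>_def)
  moreover have "alphabet chain_automaton = {..<p}" by (simp add: chain_automaton_def)
  ultimately show gen: "generated_by_finite_p_automaton p (GM M)"
    unfolding generated_by_finite_p_automaton_def using A iso_GM by (intro exI[of _ A] exI[of _ S']) simp
  show "residually_p_finite p (GM M)"
    using assms(1) _ gen
    by (rule residually_p_finite_if_generated_by_p_automaton) (simp add: GM_def group_presented_group)
qed

end
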